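(* For all fixed constants $k$ and $d$, MPB can be solved in polynomial time on PB instances whose number of distinct approval votes is at most $k$ and whose scalable limit is at most $d$; that is, there is a polynomial-time algorithm that, given such an instance, finds a feasible $S\subseteq P$ maximizing $\min_{i\in N}u_i(S)$.
   Context: A PB instance is $\langle N,P,c,b,\mathcal{A}\rangle$ with voters $N=\{1,\dots,n\}$, projects $P=\{p_1,\dots,p_m\}$, costs $c:P\to\mathbb{N}$, budget $b\in\mathbb{N}$, and approval sets $A_i\subseteq P$ for $i\in N$. $c(S)=\sum_{p\in S}c(p)$; $S$ is feasible if $c(S)\le b$; $u_i(S)=c(S\cap A_i)$. The number of distinct votes is the number of distinct sets among $A_1,\dots,A_n$. The scalable limit of the instance is $\delta=\frac{\max(c(p_1),\dots,c(p_m))}{\gcd(c(p_1),\dots,c(p_m),b)}$. *)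

theory Defs
  imports Main
begin

text \<open>An instance with n voters (indexed 0..<n) and m projects (indexed 0..<m),
  cost function c (relevant on 0..<m), budget b and approval sets A i (i < n).\<close>

definition pb_valid :: "nat \<Rightarrow> nat \<Rightarrow> (nat \<Rightarrow> nat) \<Rightarrow> nat \<Rightarrow> (nat \<Rightarrow> nat set) \<Rightarrow> bool" where
  "pb_valid n m c b A \<longleftrightarrow> (\<forall>i<n. A i \<subseteq> {..<m})"

definition set_cost :: "(nat \<Rightarrow> nat) \<Rightarrow> nat set \<Rightarrow> nat" where
  "set_cost c S = (\<Sum>p\<in>S. c p)"

definition feasible :: "nat \<Rightarrow> (nat \<Rightarrow> nat) \<Rightarrow> nat \<Rightarrow> nat set \<Rightarrow> bool" where
  "feasible m c b S \<longleftrightarrow> S \<subseteq> {..<m} \<and> set_cost c S \<le> b"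

definition utility :: "(nat \<Rightarrow> nat) \<Rightarrow> (nat \<Rightarrow> nat set) \<Rightarrow> nat \<Rightarrow> nat set \<Rightarrow> nat" where
  "utility c A i S = set_cost c (S \<inter> A i)"

definition egal :: "nat \<Rightarrow> (nat \<Rightarrow> nat) \<Rightarrow> (nat \<Rightarrow> nat set) \<Rightarrow> nat set \<Rightarrow> nat" where
  "egal n c A S = Min ((\<lambda>i. utility c A i S) ` {..<n})"

definition mpb_optimal :: "nat \<Rightarrow> nat \<Rightarrow> (nat \<Rightarrow> nat) \<Rightarrow> nat \<Rightarrow> (nat \<Rightarrow> nat set) \<Rightarrow> nat set \<Rightarrow> bool" where
  "mpb_optimal n m c b A S \<longleftrightarrow> feasible m c b S \<and>
     (\<forall>T. feasible m c b T \<longrightarrow> egal n c A T \<le> egal n c A S)"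

definition distinct_votes :: "nat \<Rightarrow> (nat \<Rightarrow> nat set) \<Rightarrow> nat" where
  "distinct_votes n A = card (A ` {..<n})"

text \<open>Scalable limit max(c(p_1),...,c(p_m)) / gcd(c(p_1),...,c(p_m),b).
  The quotient is an integer (the gcd divides the max); we use nat division.\<close>
definition scalable_limit :: "nat \<Rightarrow> (nat \<Rightarrow> nat) \<Rightarrow> nat \<Rightarrow> nat" where
  "scalable_limit m c b = Max (c ` {..<m} \<union> {0}) div Gcd (c ` {..<m} \<union> {b})"

datatype instr =
    LoadC nat nat
  | Add nat nat nat
  | Sub nat nat nat
  | Read nat nat
  | Write nat nat
  | Jz nat nat

type_synonym prog = "instr list"
type_synonym conf = "nat \<times> (nat \<Rightarrow> nat)"

fun exec_instr :: "instr \<Rightarrow> conf \<Rightarrow> conf" where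
  "exec_instr (LoadC r v) (pc, mem) = (Suc pc, mem(r := v))"
| "exec_instr (Add r a b) (pc, mem) = (Suc pc, mem(r := mem a + mem b))"
| "exec_instr (Sub r a b) (pc, mem) = (Suc pc, mem(r := mem a - mem b))"
| "exec_instr (Read r a) (pc, mem) = (Suc pc, mem(r := mem (mem a)))"
| "exec_instr (Write a r) (pc, mem) = (Suc pc, mem(mem a := mem r))"
| "exec_instr (Jz r t) (pc, mem) = ((if mem r = 0 then t else Suc pc), mem)"

definition halted :: "prog \<Rightarrow> conf \<Rightarrow> bool" where
  "halted p cf \<longleftrightarrow> length p \<le> fst cf"

definition step :: "prog \<Rightarrow> conf \<Rightarrow> conf" where
  "step p cf = (if halted p cf then cf else exec_instr (p ! fst cf) cf)"

definition run :: "prog \<Rightarrow> nat \<Rightarrow> conf \<Rightarrow> conf" where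
  "run p t cf = (step p ^^ t) cf"

definition init_conf :: "nat list \<Rightarrow> conf" where
  "init_conf xs = (0, \<lambda>a. if a = 0 then length xs
                          else if a \<le> length xs then xs ! (a - 1) else 0)"

definition ram_output :: "conf \<Rightarrow> nat list" where
  "ram_output cf = map (\<lambda>i. snd cf (Suc i)) [0..<snd cf 0]"

definition bitlen :: "nat \<Rightarrow> nat" where
  "bitlen x = (LEAST k. x < 2 ^ k)"

definition input_size :: "nat list \<Rightarrow> nat" where
  "input_size xs = (\<Sum>x\<leftarrow>xs. bitlen x + 1)"

definition encode_instance :: "nat \<Rightarrow> nat \<Rightarrow> (nat \<Rightarrow> nat) \<Rightarrow> nat \<Rightarrow> (nat \<Rightarrow> nat set) \<Rightarrow> nat list" where
  "encode_instance n m c b A =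
     [n, m, b] @ map c [0..<m] @
     concat (map (\<lambda>i. map (\<lambda>j. if j \<in> A i then 1 else 0) [0..<m]) [0..<n])"

definition decodes_to :: "nat \<Rightarrow> nat list \<Rightarrow> nat set \<Rightarrow> bool" where
  "decodes_to m out S \<longleftrightarrow> length out = m \<and> set out \<subseteq> {0, 1} \<and>
     S = {j. j < m \<and> out ! j = 1}"

end

theory Submission
  imports Defs "HOL-Library.FuncSet"
begin

text \<open>Process the projects one after the other and keep a list of feasible sets, one for every
  attainable profile (cost, utilities of all voters). Two sets with the same profile are
  interchangeable, also after adding the same further project, so extending each listed set by the
  current project and discarding repeated profiles loses nothing. Every profile entry is the gcd \<open>g\<close>
  times a number at most \<open>m * d\<close>, and there are at most \<open>k + 1\<close> different entries, so the list never
  exceeds \<open>(m * d + 1) ^ (k + 1)\<close>. Neither \<open>g\<close> nor the classes of equal votes have to be computed: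
  one program works for all \<open>k\<close> and \<open>d\<close>, only the exponent of the running time depends on them.

  For \<open>m = 0\<close> the number of voters is not bounded by the input length, so the program then sets
  \<open>n\<close> to 0.\<close>

subsection \<open>Structured programs on the RAM\<close>

text \<open>The bound \<open>m * d\<close> comes from the definition of the scalable limit: every
  cost is \<open>g\<close> times a number at most \<open>d\<close>, and an entry sums at most
  \<open>m\<close> of them. One of the \<open>k + 1\<close> entries is the cost, which behaves like
  the utility of a voter approving everything. Every instruction counts as one step whatever the
  size of its operands, so the time depends on the number of input cells only. The machine has no
  multiplication and no comparison, only addition, truncated subtraction and a test for zero. This
  shapes the loops: rows of a matrix are reached by repeatedly adding the row length, and equality,
  order and minimum are all expressed by differences. Jumps are absolute and the input lies in the
  very cells used as registers, so the proof needs a calculus independent of code position, and care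
  when entering and leaving the program.\<close>

type_synonym mem = "nat \<Rightarrow> nat"

datatype com = Blk "instr list" | Seq com com (infixr ";;" 60) | While nat com | When nat com

fun csize :: "com \<Rightarrow> nat" where
  "csize (Blk is) = length is"
| "csize (c1 ;; c2) = csize c1 + csize c2"
| "csize (While r c) = csize c + 3"
| "csize (When r c) = csize c + 1"

text \<open>Register 0 serves as the zero needed for the unconditional jump back.\<close>

fun compile :: "nat \<Rightarrow> com \<Rightarrow> prog" where
  "compile l (Blk is) = is"
| "compile l (c1 ;; c2) = compile l c1 @ compile (l + csize c1) c2"
| "compile l (While r c) =
     Jz r (l + csize c + 3) # compile (Suc l) c @ [LoadC 0 0, Jz 0 l]"
| "compile l (When r c) = Jz r (l + csize c + 1) # compile (Suc l) c"

lemma length_compile [simp]: "length (compile l c) = csize c"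
  by (induction c arbitrary: l) auto

text \<open>Total correctness with a step bound. Jumps are absolute, so the arbitrary context
  \<open>pre\<close>, \<open>post\<close> is what makes the rules compositional: the neighbours of a
  subprogram are simply moved into its context.\<close>

definition wp :: "com \<Rightarrow> nat \<Rightarrow> (mem \<Rightarrow> bool) \<Rightarrow> mem \<Rightarrow> bool" where
  "wp c T Q s \<longleftrightarrow> (\<forall>pre post. \<exists>t\<le>T. \<exists>s'.
     (step (pre @ compile (length pre) c @ post) ^^ t) (length pre, s)
       = (length pre + csize c, s') \<and> Q s')"

fun straight :: "instr \<Rightarrow> bool" where
  "straight (Jz _ _) = False"
| "straight _ = True"

fun effs :: "instr list \<Rightarrow> mem \<Rightarrow> mem" where
  "effs [] s = s"
| "effs (i # is) s = effs is (snd (exec_instr i (0, s)))"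

lemma effs_append: "effs (is @ js) s = effs js (effs is s)"
  by (induction "is" arbitrary: s) auto

lemma wp_mono:
  assumes "wp c T Q s" "T \<le> T'" "\<And>s'. Q s' \<Longrightarrow> Q' s'"
  shows "wp c T' Q' s"
  unfolding wp_def
proof (intro allI)
  fix pre post
  show "\<exists>t\<le>T'. \<exists>s'. (step (pre @ compile (length pre) c @ post) ^^ t) (length pre, s)
       = (length pre + csize c, s') \<and> Q' s'"
    using assms(1)[unfolded wp_def, rule_format, of pre post] assms(2,3) le_trans by blast
qed

lemma wp_post: "wp c T Q s \<Longrightarrow> (\<And>s'. Q s' \<Longrightarrow> Q' s') \<Longrightarrow> wp c T Q' s"
  by (rule wp_mono[OF _ order.refl])

lemma step_nth:
  "step (pre @ i # post) (length pre, s) = exec_instr i (length pre, s)"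
  by (simp add: step_def halted_def)

lemma exec_straight: "straight i \<Longrightarrow> exec_instr i (l, s) = (Suc l, snd (exec_instr i (0, s)))"
  by (cases i) auto

lemma run_straight:
  assumes "list_all straight is"
  shows "(step (pre @ is @ post) ^^ length is) (length pre, s) = (length pre + length is, effs is s)"
  using assms
proof (induction "is" arbitrary: pre s)
  case (Cons i "is")
  have "step (pre @ (i # is) @ post) (length pre, s) = (length (pre @ [i]), snd (exec_instr i (0, s)))"
    using step_nth[of pre i "is @ post" s] exec_straight[of i "length pre" s] Cons.prems by simp
  moreover have "(step (pre @ (i # is) @ post) ^^ length is) (length (pre @ [i]), snd (exec_instr i (0, s)))
      = (length (pre @ [i]) + length is, effs is (snd (exec_instr i (0, s))))"
    using Cons.IH[of "pre @ [i]" "snd (exec_instr i (0, s))"] Cons.prems by simp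
  ultimately show ?case
    unfolding length_Cons funpow_Suc_right o_apply by simp
qed simp

lemma wp_Blk:
  assumes "list_all straight is" "length is \<le> T" "Q (effs is s)"
  shows "wp (Blk is) T Q s"
  unfolding wp_def using run_straight[OF assms(1)] assms(2,3) by auto

lemma wp_Seq:
  assumes "wp c1 T1 Q1 s" "\<And>s'. Q1 s' \<Longrightarrow> wp c2 T2 Q s'" "T1 + T2 \<le> T"
  shows "wp (c1 ;; c2) T Q s"
  unfolding wp_def
proof (intro allI)
  fix pre post
  let ?p = "pre @ compile (length pre) (c1 ;; c2) @ post"
  obtain t1 s1 where 1: "t1 \<le> T1" "Q1 s1"
    "(step ?p ^^ t1) (length pre, s) = (length pre + csize c1, s1)"
    using assms(1)[unfolded wp_def, rule_format, of pre "compile (length pre + csize c1) c2 @ post"]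
    by auto
  obtain t2 s2 where 2: "t2 \<le> T2" "Q s2"
    "(step ?p ^^ t2) (length pre + csize c1, s1) = (length pre + csize c1 + csize c2, s2)"
    using assms(2)[OF 1(2), unfolded wp_def, rule_format, of "pre @ compile (length pre) c1" post]
    by auto
  have "(step ?p ^^ (t2 + t1)) (length pre, s) = (length pre + csize (c1 ;; c2), s2)"
    using 1 2 by (simp add: funpow_add add.assoc)
  then show "\<exists>t\<le>T. \<exists>s'. (step ?p ^^ t) (length pre, s) = (length pre + csize (c1 ;; c2), s') \<and> Q s'"
    using 1 2 assms(3) by (intro exI[of _ "t2 + t1"]) auto
qed

text \<open>Passes on the literal state after the block, so no intermediate assertion has to be
  invented for straight-line code.\<close>

lemma wp_Blk_Seq:
  assumes "list_all straight is" "wp c T Q (effs is s)" "length is + T \<le> T'"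
  shows "wp (Blk is ;; c) T' Q s"
  by (rule wp_Seq[where ?Q1.0 = "\<lambda>s'. s' = effs is s", OF wp_Blk]) (use assms in auto)

lemma step_Jz: "step (pre @ Jz r l # post) (length pre, s) = (if s r = 0 then l else Suc (length pre), s)"
  by (simp add: step_nth)

lemma wp_When:
  assumes "s r \<noteq> 0 \<Longrightarrow> wp c T Q s" "s r = 0 \<Longrightarrow> Q s"
  shows "wp (When r c) (T + 1) Q s"
  unfolding wp_def
proof (intro allI)
  fix pre post
  let ?p = "pre @ compile (length pre) (When r c) @ post"
  have 1: "(step ?p ^^ 1) (length pre, s) =
    (if s r = 0 then length pre + csize c + 1 else Suc (length pre), s)"
    using step_Jz[of pre r] by simp
  show "\<exists>t\<le>T+1. \<exists>s'. (step ?p ^^ t) (length pre, s) = (length pre + csize (When r c), s') \<and> Q s'"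
  proof (cases "s r = 0")
    case True
    then show ?thesis using assms(2) by (intro exI[of _ 1]) (use 1 in simp)
  next
    case False
    obtain t s' where 2: "t \<le> T" "Q s'"
      "(step ?p ^^ t) (Suc (length pre), s) = (Suc (length pre) + csize c, s')"
      using assms(1)[OF False, unfolded wp_def, rule_format, of "pre @ [Jz r (length pre + csize c + 1)]" post]
      by auto
    have "(step ?p ^^ (t + 1)) (length pre, s) = (length pre + csize (When r c), s')"
      unfolding funpow_add o_apply 1 using 2 False by simp
    then show ?thesis using 2 by (intro exI[of _ "t + 1"]) auto
  qed
qed

text \<open>One unrolling. The 3 extra steps are the test, the clearing of register 0 and the jump
  back; the clearing is why the remaining loop starts in \<open>s'(0 := 0)\<close>.\<close>

lemma wp_While_step:
  assumes "s r \<noteq> 0" "wp c T Q1 s" "\<And>s'. Q1 s' \<Longrightarrow> wp (While r c) T2 Q (s'(0 := 0))"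
  shows "wp (While r c) (T + 3 + T2) Q s"
  unfolding wp_def
proof (intro allI)
  fix pre post :: prog
  let ?l = "length pre"
  let ?p = "pre @ compile ?l (While r c) @ post"
  obtain t s1 where 1: "t \<le> T" "Q1 s1"
    "(step ?p ^^ t) (Suc ?l, s) = (Suc ?l + csize c, s1)"
    using assms(2)[unfolded wp_def, rule_format,
        of "pre @ [Jz r (?l + csize c + 3)]" "[LoadC 0 0, Jz 0 ?l] @ post"]
    by auto
  have 0: "(step ?p ^^ 1) (?l, s) = (Suc ?l, s)"
    using step_Jz[of pre r] assms(1) by simp
  have 2: "step ?p (Suc ?l + csize c, s1) = (Suc (Suc ?l + csize c), s1(0 := 0))"
    using step_nth[of "pre @ Jz r (?l + csize c + 3) # compile (Suc ?l) c" "LoadC 0 0" "Jz 0 ?l # post" s1]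
    by simp
  have 3: "step ?p (Suc (Suc ?l + csize c), s1(0 := 0)) = (?l, s1(0 := 0))"
    using step_nth[of "pre @ Jz r (?l + csize c + 3) # compile (Suc ?l) c @ [LoadC 0 0]" "Jz 0 ?l" post "s1(0 := 0)"]
    by simp
  have 23: "(step ?p ^^ 2) (Suc ?l + csize c, s1) = (?l, s1(0 := 0))"
    unfolding numeral_2_eq_2 funpow.simps o_apply id_apply 2 3 ..
  obtain t2 s2 where 4: "t2 \<le> T2" "Q s2"
    "(step ?p ^^ t2) (?l, s1(0 := 0)) = (?l + csize (While r c), s2)"
    using assms(3)[OF 1(2), unfolded wp_def] by blast
  have "(step ?p ^^ (t2 + (2 + (t + 1)))) (?l, s) = (?l + csize (While r c), s2)"
    unfolding funpow_add o_apply 0 1(3) 23 4(3) ..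
  moreover have "t2 + (2 + (t + 1)) \<le> T + 3 + T2" using 1 4 by simp
  ultimately show "\<exists>t\<le>T + 3 + T2. \<exists>s'. (step ?p ^^ t) (?l, s) = (?l + csize (While r c), s') \<and> Q s'"
    using 4(2) by blast
qed

lemma wp_While_stop:
  assumes "s r = 0" "Q s"
  shows "wp (While r c) 1 Q s"
  unfolding wp_def using step_Jz[of _ r] assms by (intro allI exI[of _ 1]) simp

text \<open>Register 1 holds the constant 1.\<close>

definition For :: "nat \<Rightarrow> com \<Rightarrow> com" where
  "For r c = While r (c ;; Blk [Sub r r 1])"

text \<open>The index \<open>i\<close> counts finished rounds while the register counts down. The
  body has to establish \<open>I\<close> for the state after the decrement and the clearing of
  register 0, so invariants are only needed at the loop head. Each round costs 4 steps beyond the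
  body: the decrement and the 3 of \<open>While\<close>.\<close>

lemma wp_For:
  assumes r: "r > 1" and init: "I 0 s" "s r = N"
    and body: "\<And>i s. i < N \<Longrightarrow> I i s \<Longrightarrow> s r = N - i \<Longrightarrow>
      wp c T (\<lambda>s'. s' r = N - i \<and> s' 1 = 1 \<and> I (Suc i) (s'(r := N - Suc i, 0 := 0))) s"
    and fin: "\<And>s'. I N s' \<Longrightarrow> s' r = 0 \<Longrightarrow> Q s'"
    and T': "N * (T + 4) + 1 \<le> T'"
  shows "wp (For r c) T' Q s"
proof -
  \<comment> \<open>Induction on the number \<open>d\<close> of rounds left, hence the invariant
    index \<open>N - d\<close>.\<close>
  have "wp (For r c) (d * (T + 4) + 1) Q s" if "d \<le> N" "I (N - d) s" "s r = d" for d s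
    using that
  proof (induction d arbitrary: s)
    case 0
    then show ?case unfolding For_def by (intro wp_mono[OF wp_While_stop]) (auto intro: fin)
  next
    case (Suc d)
    let ?Q1 = "\<lambda>s'. s' r = Suc d \<and> s' 1 = 1 \<and> I (N - d) (s'(r := d, 0 := 0))"
    have eq: "Suc (N - Suc d) = N - d" "N - (N - Suc d) = Suc d" using Suc.prems(1) by auto
    have 1: "wp c T ?Q1 s"
      using body[of "N - Suc d" s] Suc.prems eq by simp
    have 2: "wp (c ;; Blk [Sub r r 1]) (T + 1) (\<lambda>s'. s' r = d \<and> I (N - d) (s'(0 := 0))) s"
      using r by (intro wp_Seq[OF 1] wp_Blk) (auto simp: fun_upd_twist)
    have "wp (While r (c ;; Blk [Sub r r 1])) (T + 1 + 3 + (d * (T + 4) + 1)) Q s"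
    proof (rule wp_While_step[OF _ 2])
      show "s r \<noteq> 0" using Suc.prems by simp
      fix s' assume "s' r = d \<and> I (N - d) (s'(0 := 0))"
      then show "wp (While r (c ;; Blk [Sub r r 1])) (d * (T + 4) + 1) Q (s'(0 := 0))"
        using Suc.IH[of "s'(0 := 0)"] Suc.prems(1) r unfolding For_def
        by (simp del: fun_upd_apply add: fun_upd_other)
    qed
    then show ?case unfolding For_def by (simp add: algebra_simps)
  qed
  from this[of N s] init show ?thesis using T' by (auto intro: wp_mono)
qed

subsection \<open>Loops\<close>

text \<open>Register allocation: 1 holds the constant 1, 2 the number \<open>N\<close> of profile entries, 3 the number
  \<open>m\<close> of projects, 4 the budget, 5 the start of the list of records, 6 its end, 7 the record size
  \<open>N + m\<close>, 8 the address of the cost of the current project \<open>j\<close>, 9 the counter \<open>m - j\<close>, 10 the cost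
  of \<open>j\<close>, 11 the record being extended, 12 a counter of the records still to be extended, 13 the number of
  records, 25 the best record; 0 and 14 to 24 are scratch. A record consists of the \<open>N\<close> profile
  entries followed by the characteristic vector of the set.\<close>

definition copy_loop :: com where
  "copy_loop = For 16 (Blk [Read 17 14, Write 15 17, Add 14 14 1, Add 15 15 1])"

lemma wp_copy:
  assumes "s 1 = 1" "s 14 = p" "s 15 = w" "s 16 = N" "25 < w" "25 < p" "w + N \<le> p \<or> p + N \<le> w"
    "8 * N + 1 \<le> T"
  shows "wp copy_loop T (\<lambda>s'. (\<forall>i<N. s' (w + i) = s (p + i)) \<and> s' 14 = p + N \<and> s' 15 = w + N
    \<and> (\<forall>a. a \<notin> {0, 14, 15, 16, 17} \<longrightarrow> (a < w \<or> w + N \<le> a) \<longrightarrow> s' a = s a)) s"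
proof -
  define I where "I = (\<lambda>n s'. (\<forall>i<n. s' (w + i) = s (p + i)) \<and> s' 14 = p + n \<and> s' 15 = w + n
    \<and> (\<forall>a. a \<notin> {0, 14, 15, 16, 17} \<longrightarrow> (a < w \<or> w + n \<le> a) \<longrightarrow> s' a = s a))"
  show ?thesis
    unfolding copy_loop_def
  proof (rule wp_For[where I = I and N = N and T = 4])
    fix i s' assume i: "i < N" and I: "I i s'" and c: "s' 16 = N - i"
    have "s' (p + i) = s (p + i)" "s' 1 = 1"
      using I i assms by (auto simp: I_def)
    then show "wp (Blk [Read 17 14, Write 15 17, Add 14 14 1, Add 15 15 1]) 4
      (\<lambda>s''. s'' 16 = N - i \<and> s'' 1 = 1 \<and> I (Suc i) (s''(16 := N - Suc i, 0 := 0))) s'"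
      using I i c assms by (intro wp_Blk) (auto simp: I_def less_Suc_eq)
  qed (use assms in \<open>auto simp: I_def\<close>)
qed

text \<open>Register 14 walks down one column of the input matrix: adding the row length from
  register 3 leads to the same project in the next row.\<close>

definition update_loop :: com where
  "update_loop = For 16 (Blk [Read 17 14] ;;
     When 17 (Blk [Read 18 15, Add 18 18 10, Write 15 18]) ;; Blk [Add 14 14 3, Add 15 15 1])"

lemma wp_update:
  assumes "s 1 = 1" "s 3 = m" "s 10 = v" "s 14 = p" "s 15 = w" "s 16 = N" "25 < w" "25 < p"
    and sep: "\<And>i. i < N \<Longrightarrow> p + i * m < w"
    and T: "11 * N + 1 \<le> T"
  shows "wp update_loop T (\<lambda>s'.
    (\<forall>i<N. s' (w + i) = s (w + i) + (if s (p + i * m) = 0 then 0 else v)) \<and> s' 15 = w + N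
    \<and> (\<forall>a. a \<notin> {0, 14, 15, 16, 17, 18} \<longrightarrow> (a < w \<or> w + N \<le> a) \<longrightarrow> s' a = s a)) s"
proof -
  define I where "I = (\<lambda>n s'. 
    (\<forall>i<n. s' (w + i) = s (w + i) + (if s (p + i * m) = 0 then 0 else v))
    \<and> s' 14 = p + n * m \<and> s' 15 = w + n
    \<and> (\<forall>a. a \<notin> {0, 14, 15, 16, 17, 18} \<longrightarrow> (a < w \<or> w + n \<le> a) \<longrightarrow> s' a = s a))"
  show ?thesis
    unfolding update_loop_def
  proof (rule wp_For[where I = I and N = N and T = 7])
    fix i s' assume i: "i < N" and I: "I i s'" and c: "s' 16 = N - i"
    have *: "s' (p + i * m) = s (p + i * m)" "s' 1 = 1" "s' 3 = m" "s' 10 = v" "s' (w + i) = s (w + i)"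
      using I i assms(1-8) sep[OF i] by (auto simp: I_def)
    show "wp (Blk [Read 17 14] ;;
     When 17 (Blk [Read 18 15, Add 18 18 10, Write 15 18]) ;; Blk [Add 14 14 3, Add 15 15 1]) 7
      (\<lambda>s''. s'' 16 = N - i \<and> s'' 1 = 1 \<and> I (Suc i) (s''(16 := N - Suc i, 0 := 0))) s'"
      apply (rule wp_Blk_Seq, simp)
       apply (rule wp_Seq)
         apply (rule wp_When[where T = 3 and Q = "\<lambda>t. t 16 = N - i \<and> t 1 = 1 \<and> t 3 = m \<and> t 14 = p + i * m \<and> t 15 = w + i \<and>
            t (w + i) = s (w + i) + (if s (p + i * m) = 0 then 0 else v) \<and>
            (\<forall>a. a \<notin> {0, 14, 15, 16, 17, 18} \<longrightarrow> a \<noteq> w + i \<longrightarrow> t a = s' a)"])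
          apply (rule wp_Blk; use I i c * assms(1-8) in \<open>simp add: I_def\<close>)
         apply (use I i c * assms(1-8) in \<open>simp add: I_def\<close>)
        apply (rule wp_Blk[where T = 2])
          apply simp
         apply simp
        apply (use I i c * assms(1-8) in \<open>auto simp: I_def less_Suc_eq\<close>)
      done
  qed (use assms in \<open>auto simp: I_def\<close>)
qed

text \<open>Under truncated subtraction \<open>(x - y) + (y - x)\<close> is the distance of
  \<open>x\<close> and \<open>y\<close>, so the sum in register 19 stays 0 exactly as long as the
  two profiles agree.\<close>

definition compare_loop :: com where
  "compare_loop = For 16 (Blk [Read 17 14, Read 18 15, Sub 20 17 18, Add 19 19 20,
     Sub 20 18 17, Add 19 19 20, Add 14 14 1, Add 15 15 1])"

lemma wp_compare:
  assumes "s 1 = 1" "s 14 = p" "s 15 = q" "s 16 = N" "s 19 = 0" "25 < p" "25 < q"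
    and T: "12 * N + 1 \<le> T"
  shows "wp compare_loop T (\<lambda>s'. (s' 19 = 0 \<longleftrightarrow> (\<forall>i<N. s (p + i) = s (q + i)))
    \<and> (\<forall>a. a \<notin> {0, 14, 15, 16, 17, 18, 19, 20} \<longrightarrow> s' a = s a)) s"
proof -
  define I where "I = (\<lambda>n s'. (s' 19 = 0 \<longleftrightarrow> (\<forall>i<n. s (p + i) = s (q + i)))
    \<and> s' 14 = p + n \<and> s' 15 = q + n
    \<and> (\<forall>a. a \<notin> {0, 14, 15, 16, 17, 18, 19, 20} \<longrightarrow> s' a = s a))"
  show ?thesis
    unfolding compare_loop_def
  proof (rule wp_For[where I = I and N = N and T = 8])
    fix i s' assume i: "i < N" and I: "I i s'" and c: "s' 16 = N - i"
    have "s' (p + i) = s (p + i)" "s' (q + i) = s (q + i)" "s' 1 = 1"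
      using I i assms by (auto simp: I_def)
    moreover have "(\<forall>j<Suc i. s (p + j) = s (q + j)) \<longleftrightarrow>
        (\<forall>j<i. s (p + j) = s (q + j)) \<and> s (p + i) - s (q + i) = 0 \<and> s (q + i) - s (p + i) = 0"
      by (auto simp: less_Suc_eq)
    ultimately show "wp (Blk [Read 17 14, Read 18 15, Sub 20 17 18, Add 19 19 20,
     Sub 20 18 17, Add 19 19 20, Add 14 14 1, Add 15 15 1]) 8
      (\<lambda>s''. s'' 16 = N - i \<and> s'' 1 = 1 \<and> I (Suc i) (s''(16 := N - Suc i, 0 := 0))) s'"
      using I i c assms by (intro wp_Blk) (simp_all add: I_def)
  qed (use assms in \<open>auto simp: I_def\<close>)
qed

text \<open>One register decides both conditions. It starts with the excess of the cost over the
  budget, and each stored record of the same profile adds 1, so it ends at 0 iff the candidate is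
  affordable and new.\<close>

definition dup_test :: com where
  "dup_test = Blk [Read 23 6, Sub 23 23 4, LoadC 21 0, Add 21 21 5, LoadC 22 0, Add 22 22 13] ;;
   For 22 (Blk [LoadC 14 0, Add 14 14 21, LoadC 15 0, Add 15 15 6, LoadC 16 0, Add 16 16 2, LoadC 19 0] ;;
     compare_loop ;; Blk [Sub 19 1 19, Add 23 23 19, Add 21 21 7])"

lemma wp_dup:
  assumes "s 1 = 1" "s 2 = N" "s 4 = b" "s 5 = l" "s 6 = t" "s 7 = R" "s 13 = L" "25 < l" "25 < t"
    and T: "L * (12 * N + 15) + 7 \<le> T"
  shows "wp dup_test T (\<lambda>s'.
    (s' 23 = 0 \<longleftrightarrow> s t \<le> b \<and> (\<forall>q<L. \<exists>i<N. s (l + q * R + i) \<noteq> s (t + i)))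
    \<and> (\<forall>a. a \<notin> {0, 14, 15, 16, 17, 18, 19, 20, 21, 22, 23} \<longrightarrow> s' a = s a)) s"
proof -
  define I where "I = (\<lambda>n s'. (s' 23 = 0 \<longleftrightarrow> s t \<le> b \<and> (\<forall>q<n. \<exists>i<N. s (l + q * R + i) \<noteq> s (t + i)))
    \<and> s' 21 = l + n * R
    \<and> (\<forall>a. a \<notin> {0, 14, 15, 16, 17, 18, 19, 20, 21, 22, 23} \<longrightarrow> s' a = s a))"
  show ?thesis
    unfolding dup_test_def
  proof (rule wp_Blk_Seq[where T = "L * (12 * N + 15) + 1"], simp,
      rule wp_For[where I = I and N = L and T = "12 * N + 11"])
    fix i s' assume i: "i < L" and I: "I i s'" and c: "s' 22 = L - i"
    have *: "s' 1 = 1" "s' 2 = N" "s' 6 = t" "s' 7 = R" "\<And>j. s' (l + i * R + j) = s (l + i * R + j)"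
      "\<And>j. s' (t + j) = s (t + j)"
      using I i assms by (auto simp: I_def)
    show "wp (Blk [LoadC 14 0, Add 14 14 21, LoadC 15 0, Add 15 15 6, LoadC 16 0, Add 16 16 2, LoadC 19 0] ;;
     compare_loop ;; Blk [Sub 19 1 19, Add 23 23 19, Add 21 21 7]) (12 * N + 11)
      (\<lambda>s''. s'' 22 = L - i \<and> s'' 1 = 1 \<and> I (Suc i) (s''(22 := L - Suc i, 0 := 0))) s'"
      apply (rule wp_Blk_Seq[where T = "12 * N + 4"], simp)
       apply (rule wp_Seq)
         apply (rule wp_compare[where p = "l + i * R" and q = t and N = N and T = "12 * N + 1"])
                apply (use I * assms(1-9) in \<open>simp_all add: I_def\<close>)
      apply (rule wp_Blk[where T = 3])
        apply simp
       apply simp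
      apply (use I i c * assms(1-9) in \<open>auto simp: I_def less_Suc_eq\<close>)
      done
  qed (use assms in \<open>auto simp: I_def\<close>)
qed

definition min_loop :: com where
  "min_loop = For 16 (Blk [Read 17 14, Sub 17 18 17, Sub 18 18 17, Add 14 14 1])"

lemma wp_min:
  assumes "s 1 = 1" "s 14 = p" "s 16 = N" "s 18 = s p" "25 < p" "0 < N"
    and T: "8 * N + 1 \<le> T"
  shows "wp min_loop T (\<lambda>s'. s' 18 = Min ((\<lambda>i. s (p + i)) ` {..<N})
    \<and> (\<forall>a. a \<notin> {0, 14, 16, 17, 18} \<longrightarrow> s' a = s a)) s"
proof -
  \<comment> \<open>The witness ranges over all \<open>N\<close> entries instead of the first
    \<open>n\<close>, so that the invariant holds from the start: register 18 is initialised with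
    the first entry.\<close>
  define I where "I = (\<lambda>n s'. (\<forall>i<n. s' 18 \<le> s (p + i)) \<and> (\<exists>i<N. s' 18 = s (p + i))
    \<and> s' 14 = p + n \<and> (\<forall>a. a \<notin> {0, 14, 16, 17, 18} \<longrightarrow> s' a = s a))"
  show ?thesis
    unfolding min_loop_def
  proof (rule wp_For[where I = I and N = N and T = 4])
    show "I 0 s"
      unfolding I_def using assms by (auto intro!: exI[of _ 0])
    fix i s' assume i: "i < N" and I: "I i s'" and c: "s' 16 = N - i"
    have "s' (p + i) = s (p + i)" "s' 1 = 1"
      using I i assms by (auto simp: I_def)
    moreover have "x - (x - y) = min x y" for x y :: nat by auto
    moreover have "\<exists>j<N. min (s' 18) (s (p + i)) = s (p + j)"
      using I i by (auto simp: I_def min_def)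
    ultimately show "wp (Blk [Read 17 14, Sub 17 18 17, Sub 18 18 17, Add 14 14 1]) 4
      (\<lambda>s''. s'' 16 = N - i \<and> s'' 1 = 1 \<and> I (Suc i) (s''(16 := N - Suc i, 0 := 0))) s'"
      using I i c assms by (intro wp_Blk) (auto simp: I_def less_Suc_eq min_le_iff_disj)
  next
    fix s' assume "I N s'"
    then show "s' 18 = Min ((\<lambda>i. s (p + i)) ` {..<N}) \<and> (\<forall>a. a \<notin> {0, 14, 16, 17, 18} \<longrightarrow> s' a = s a)"
      unfolding I_def by (auto intro!: Min_eqI[symmetric])
  qed (use assms in auto)
qed

definition select :: com where
  "select = Blk [LoadC 21 0, Add 21 21 5, LoadC 22 0, Add 22 22 13, LoadC 24 0, LoadC 25 0, Add 25 25 5] ;;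
   For 22 (Blk [LoadC 14 0, Add 14 14 21, LoadC 16 0, Add 16 16 2, Read 18 14] ;; min_loop ;;
     Blk [Sub 17 18 24] ;; When 17 (Blk [LoadC 24 0, Add 24 24 18, LoadC 25 0, Add 25 25 21]) ;;
     Blk [Add 21 21 7])"

lemma wp_select:
  assumes "s 1 = 1" "s 2 = N" "s 5 = l" "s 7 = R" "s 13 = L" "25 < l" "0 < N" "0 < L"
    and T: "L * (8 * N + 18) + 8 \<le> T"
  shows "wp select T (\<lambda>s'. (\<exists>q<L. s' 25 = l + q * R \<and>
      (\<forall>q'<L. Min ((\<lambda>i. s (l + q' * R + i)) ` {..<N}) \<le> Min ((\<lambda>i. s (l + q * R + i)) ` {..<N})))
    \<and> (\<forall>a. a \<notin> {0, 14, 16, 17, 18, 21, 22, 24, 25} \<longrightarrow> s' a = s a)) s"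
proof -
  define M where "M = (\<lambda>q. Min ((\<lambda>i. s (l + q * R + i)) ` {..<N}))"
  \<comment> \<open>Only \<open>s' 24 \<le> M q\<close> and not equality: register 24 starts at 0
    while register 25 already points to the first record. At the end
    \<open>M q' \<le> s' 24 \<le> M q\<close> for all \<open>q'\<close>, which is optimality of
    \<open>q\<close>.\<close>
  define I where "I = (\<lambda>n s'. (\<exists>q<L. s' 25 = l + q * R \<and> s' 24 \<le> M q) \<and> (\<forall>q<n. M q \<le> s' 24)
    \<and> s' 21 = l + n * R
    \<and> (\<forall>a. a \<notin> {0, 14, 16, 17, 18, 21, 22, 24, 25} \<longrightarrow> s' a = s a))"
  show ?thesis
    unfolding select_def
  proof (rule wp_Blk_Seq[where T = "L * (8 * N + 18) + 1"], simp,
      rule wp_For[where I = I and N = L and T = "8 * N + 14"])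
    fix i s' assume i: "i < L" and I: "I i s'" and c: "s' 22 = L - i"
    have *: "s' 1 = 1" "s' 2 = N" "s' 7 = R" "s' 21 = l + i * R" "\<And>j. s' (l + i * R + j) = s (l + i * R + j)"
      using I i assms by (auto simp: I_def)
    have "s' (l + i * R) = s (l + i * R)" using *(5)[of 0] by simp
    note * = * this
    define C where "C = (\<lambda>t. t 18 = M i \<and> (\<forall>a. a \<notin> {0, 14, 16, 17, 18} \<longrightarrow> t a = s' a))"
    have upd: "wp (When 17 (Blk [LoadC 24 0, Add 24 24 18, LoadC 25 0, Add 25 25 21])) (4 + 1)
        (\<lambda>t. t 24 = max (s' 24) (M i) \<and> t 25 = (if s' 24 < M i then s' 21 else s' 25) \<and>
           (\<forall>a. a \<notin> {0, 14, 16, 17, 18, 24, 25} \<longrightarrow> t a = s' a)) (t(17 := t 18 - t 24))" if "C t" for t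
      using that unfolding C_def
      by (intro wp_When wp_Blk) auto
    have 1: "wp min_loop (8 * N + 1) C
        (effs [LoadC 14 0, Add 14 14 21, LoadC 16 0, Add 16 16 2, Read 18 14] s')"
      by (rule wp_post[OF wp_min[where p = "l + i * R" and N = N]])
        (use * assms(1-8) in \<open>simp_all add: C_def M_def\<close>)
    have 2: "wp (Blk [Add 21 21 7]) 1
        (\<lambda>s''. s'' 22 = L - i \<and> s'' 1 = 1 \<and> I (Suc i) (s''(22 := L - Suc i, 0 := 0))) t"
      if t: "t 24 = max (s' 24) (M i) \<and> t 25 = (if s' 24 < M i then s' 21 else s' 25) \<and>
           (\<forall>a. a \<notin> {0, 14, 16, 17, 18, 24, 25} \<longrightarrow> t a = s' a)" for t
    proof (rule wp_Blk)
      have reg: "t 1 = 1" "t 7 = R" "t 21 = l + i * R" "t 22 = L - i"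
        using t c * by auto
      have "\<exists>q<L. t 25 = l + q * R \<and> t 24 \<le> M q"
        using I i t *(4) unfolding I_def by (cases "s' 24 < M i") auto
      moreover have "\<forall>q<Suc i. M q \<le> t 24"
        using I t unfolding I_def by (auto simp: less_Suc_eq le_max_iff_disj)
      moreover have "t a = s a" if "a \<notin> {0, 14, 16, 17, 18, 21, 22, 24, 25}" for a
        using I t that unfolding I_def by auto
      ultimately show "effs [Add 21 21 7] t 22 = L - i \<and> effs [Add 21 21 7] t 1 = 1 \<and>
          I (Suc i) ((effs [Add 21 21 7] t)(22 := L - Suc i, 0 := 0))"
        using reg by (auto simp: I_def)
    qed auto
    have 3: "wp (Blk [Sub 17 18 24] ;; When 17 (Blk [LoadC 24 0, Add 24 24 18, LoadC 25 0, Add 25 25 21]) ;;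
        Blk [Add 21 21 7]) 7
        (\<lambda>s''. s'' 22 = L - i \<and> s'' 1 = 1 \<and> I (Suc i) (s''(22 := L - Suc i, 0 := 0))) t" if "C t" for t
      by (rule wp_Blk_Seq[OF _ wp_Seq[OF _ 2 order.refl]]) (use upd[OF that] in auto)
    show "wp (Blk [LoadC 14 0, Add 14 14 21, LoadC 16 0, Add 16 16 2, Read 18 14] ;; min_loop ;;
     Blk [Sub 17 18 24] ;; When 17 (Blk [LoadC 24 0, Add 24 24 18, LoadC 25 0, Add 25 25 21]) ;;
     Blk [Add 21 21 7]) (8 * N + 14)
      (\<lambda>s''. s'' 22 = L - i \<and> s'' 1 = 1 \<and> I (Suc i) (s''(22 := L - Suc i, 0 := 0))) s'"
      by (rule wp_Blk_Seq[OF _ wp_Seq[OF 1 3 order.refl]]) auto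
  next
    fix s' assume "I L s'"
    then obtain q where q: "q < L" "s' 25 = l + q * R" "s' 24 \<le> M q" "\<And>q'. q' < L \<Longrightarrow> M q' \<le> s' 24"
      and frame: "\<forall>a. a \<notin> {0, 14, 16, 17, 18, 21, 22, 24, 25} \<longrightarrow> s' a = s a"
      unfolding I_def by blast
    have "\<forall>q'<L. M q' \<le> M q" using q(3,4) le_trans by blast
    then show "(\<exists>q<L. s' 25 = l + q * R \<and>
        (\<forall>q'<L. Min ((\<lambda>i. s (l + q' * R + i)) ` {..<N}) \<le> Min ((\<lambda>i. s (l + q * R + i)) ` {..<N})))
      \<and> (\<forall>a. a \<notin> {0, 14, 16, 17, 18, 21, 22, 24, 25} \<longrightarrow> s' a = s a)"
      using q(1,2) frame unfolding M_def by blast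
  next
    show "I 0 (effs [LoadC 21 0, Add 21 21 5, LoadC 22 0, Add 22 22 13, LoadC 24 0, LoadC 25 0, Add 25 25 5] s)"
      unfolding I_def using assms by (intro conjI exI[of _ 0]) auto
  qed (use T assms in auto)
qed

text \<open>The project index is not stored but recovered as \<open>m - (m - j)\<close> from the
  loop counter. \<open>update_loop\<close> leaves register 15 just behind the profile, so adding
  \<open>j\<close> gives the address of the bit to be set.\<close>

definition candidate :: com where
  "candidate = Blk [LoadC 14 0, Add 14 14 11, LoadC 15 0, Add 15 15 6, LoadC 16 0, Add 16 16 7] ;;
     copy_loop ;;
     Blk [LoadC 14 0, Add 14 14 8, LoadC 15 0, Add 15 15 6, LoadC 16 0, Add 16 16 2] ;;
     update_loop ;; Blk [Sub 17 3 9, Add 15 15 17, Write 15 1]"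

lemma wp_candidate:
  assumes "s 1 = 1" "s 2 = N" "s 3 = m" "s 6 = t" "s 7 = N + m" "s 8 = z" "s 9 = m - j" "s 10 = v" "s 11 = p"
    "j < m" "25 < p" "25 < z" "p + (N + m) \<le> t"
    and sep: "\<And>i. i < N \<Longrightarrow> z + i * m < t"
    and T: "8 * (N + m) + 11 * N + 17 \<le> T"
  shows "wp candidate T (\<lambda>s'.
    (\<forall>i<N. s' (t + i) = s (p + i) + (if s (z + i * m) = 0 then 0 else v)) \<and>
    (\<forall>l<m. s' (t + N + l) = (if l = j then 1 else s (p + N + l)))
    \<and> (\<forall>a. a \<notin> {0, 14, 15, 16, 17, 18} \<longrightarrow> a < t \<longrightarrow> s' a = s a)) s"
proof -
  define C where "C = (\<lambda>s1. (\<forall>i<N+m. s1 (t + i) = s (p + i))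
     \<and> (\<forall>a. a \<notin> {0, 14, 15, 16, 17} \<longrightarrow> a < t \<longrightarrow> s1 a = s a))"
  define D where "D = (\<lambda>s2. (\<forall>i<N. s2 (t + i) = s (p + i) + (if s (z + i * m) = 0 then 0 else v))
     \<and> (\<forall>l<m. s2 (t + N + l) = s (p + N + l)) \<and> s2 15 = t + N
     \<and> (\<forall>a. a \<notin> {0, 14, 15, 16, 17, 18} \<longrightarrow> a < t \<longrightarrow> s2 a = s a))"
  have t: "25 < t" using assms by simp
  have sz: "s (z + i * m) = s1 (z + i * m)" if "C s1" "i < N" for s1 i
    using that sep[OF that(2)] assms(12) unfolding C_def by simp
  have 1: "wp copy_loop (8 * (N + m) + 1) C
      (effs [LoadC 14 0, Add 14 14 11, LoadC 15 0, Add 15 15 6, LoadC 16 0, Add 16 16 7] s)"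
    by (rule wp_post[OF wp_copy[where p = p and w = t and N = "N + m"]])
      (use assms(1-13) t in \<open>simp_all add: C_def\<close>)
  have 2: "wp update_loop (11 * N + 1) D
      (effs [LoadC 14 0, Add 14 14 8, LoadC 15 0, Add 15 15 6, LoadC 16 0, Add 16 16 2] s1)" if "C s1" for s1
  proof (rule wp_post[OF wp_update[where m = m and v = v and p = z and w = t and N = N]])
    have reg: "s1 1 = 1" "s1 2 = N" "s1 3 = m" "s1 6 = t" "s1 8 = z" "s1 10 = v"
      using that assms(1-13) t unfolding C_def by auto
    have heap: "s1 (t + i) = s (p + i)" if "i < N + m" for i
      using that \<open>C s1\<close> unfolding C_def by blast
    fix s2 assume "(\<forall>i<N. s2 (t + i) =
        effs [LoadC 14 0, Add 14 14 8, LoadC 15 0, Add 15 15 6, LoadC 16 0, Add 16 16 2] s1 (t + i) +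
        (if effs [LoadC 14 0, Add 14 14 8, LoadC 15 0, Add 15 15 6, LoadC 16 0, Add 16 16 2] s1 (z + i * m) = 0
         then 0 else v)) \<and> s2 15 = t + N \<and>
      (\<forall>a. a \<notin> {0, 14, 15, 16, 17, 18} \<longrightarrow> a < t \<or> t + N \<le> a \<longrightarrow>
        s2 a = effs [LoadC 14 0, Add 14 14 8, LoadC 15 0, Add 15 15 6, LoadC 16 0, Add 16 16 2] s1 a)"
    then have *: "\<And>i. i < N \<Longrightarrow> s2 (t + i) = s1 (t + i) + (if s1 (z + i * m) = 0 then 0 else v)"
      "s2 15 = t + N" "\<And>a. a \<notin> {0, 14, 15, 16, 17, 18} \<Longrightarrow> a < t \<or> t + N \<le> a \<Longrightarrow> s2 a = s1 a"
      using assms(12) t by auto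
    show "D s2"
      unfolding D_def
    proof (intro conjI allI impI)
      fix i assume "i < N"
      then show "s2 (t + i) = s (p + i) + (if s (z + i * m) = 0 then 0 else v)"
        using *(1) heap[of i] sz[OF that] by simp
    next
      fix l assume "l < m"
      then show "s2 (t + N + l) = s (p + N + l)"
        using *(3)[of "t + N + l"] heap[of "N + l"] t by (simp add: add.assoc)
    next
      fix a assume a: "a \<notin> {0, 14, 15, 16, 17, 18}" "a < t"
      then have "s1 a = s a" using that unfolding C_def by auto
      then show "s2 a = s a" using *(3) a by auto
    qed (use * in auto)
  qed (use that assms(1-13) t sep in \<open>auto simp: C_def\<close>)
  have 3: "wp (Blk [Sub 17 3 9, Add 15 15 17, Write 15 1]) 3 (\<lambda>s'.
    (\<forall>i<N. s' (t + i) = s (p + i) + (if s (z + i * m) = 0 then 0 else v)) \<and>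
    (\<forall>l<m. s' (t + N + l) = (if l = j then 1 else s (p + N + l)))
    \<and> (\<forall>a. a \<notin> {0, 14, 15, 16, 17, 18} \<longrightarrow> a < t \<longrightarrow> s' a = s a)) s2" if "D s2" for s2
  proof -
    have reg: "s2 1 = 1" "s2 3 = m" "s2 9 = m - j" "s2 15 = t + N"
      using that assms(1-13) t unfolding D_def by auto
    then have "effs [Sub 17 3 9, Add 15 15 17, Write 15 1] s2 = s2(17 := j, 15 := t + N + j, t + N + j := 1)"
      using \<open>j < m\<close> t by simp
    then show ?thesis
      using that t by (intro wp_Blk) (auto simp: D_def)
  qed
  show ?thesis
    unfolding candidate_def
    by (intro wp_Blk_Seq[OF _ wp_Seq[OF 1 wp_Blk_Seq[OF _ wp_Seq[OF 2 3 order.refl] order.refl] order.refl]])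
      (use T in auto)
qed

subsection \<open>Sets with pairwise distinct profiles\<close>

text \<open>Row 0 of \<open>W\<close> holds the costs, so the cost of a set is its utility for row 0:
  a project of cost 0 contributes nothing either way.\<close>

definition vec :: "(nat \<Rightarrow> nat \<Rightarrow> nat) \<Rightarrow> nat set \<Rightarrow> nat \<Rightarrow> nat" where
  "vec W S i = (\<Sum>j\<in>S. if W i j = 0 then 0 else W 0 j)"

definition vecs :: "(nat \<Rightarrow> nat \<Rightarrow> nat) \<Rightarrow> nat \<Rightarrow> nat set \<Rightarrow> nat list" where
  "vecs W N S = map (vec W S) [0..<N]"

lemma vec_insert:
  "finite S \<Longrightarrow> j \<notin> S \<Longrightarrow> vec W (insert j S) i = vec W S i + (if W i j = 0 then 0 else W 0 j)"
  by (simp add: vec_def)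

lemma vecs_eq_iff: "vecs W N S = vecs W N T \<longleftrightarrow> (\<forall>i<N. vec W S i = vec W T i)"
  by (auto simp: vecs_def)

locale table =
  fixes W :: "nat \<Rightarrow> nat \<Rightarrow> nat" and N m b :: nat
  assumes N: "0 < N"
begin

definition extend :: "nat \<Rightarrow> nat set list \<Rightarrow> nat \<Rightarrow> nat set list" where
  "extend j Ss i = (let S = insert j (Ss ! i) in
     if vec W S 0 \<le> b \<and> vecs W N S \<notin> vecs W N ` set Ss then Ss @ [S] else Ss)"

definition extend_upto :: "nat \<Rightarrow> nat set list \<Rightarrow> nat \<Rightarrow> nat set list" where
  "extend_upto j Ss i = foldl (extend j) Ss [0..<i]"

text \<open>The list grows during the traversal; the bound is its length before the round, because
  the sets appended in this round already contain \<open>j\<close>.\<close>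

fun reps :: "nat \<Rightarrow> nat set list" where
  "reps 0 = [{}]"
| "reps (Suc j) = extend_upto j (reps j) (length (reps j))"

text \<open>The invariant behind the length bound: such a list is no longer than the number of
  profiles of subsets of the projects.\<close>

definition separated :: "nat set list \<Rightarrow> bool" where
  "separated Ss \<longleftrightarrow> distinct (map (vecs W N) Ss) \<and> (\<forall>S\<in>set Ss. S \<subseteq> {..<m})"

lemma extend_upto_0 [simp]: "extend_upto j Ss 0 = Ss"
  and extend_upto_Suc [simp]: "extend_upto j Ss (Suc i) = extend j (extend_upto j Ss i) i"
  by (simp_all add: extend_upto_def)

lemma extend_prefix: "\<exists>Ts. extend j Ss i = Ss @ Ts"
  by (simp add: extend_def Let_def)

lemma extend_upto_prefix: "\<exists>Ts. extend_upto j Ss i = Ss @ Ts"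
proof (induction i)
  case (Suc i)
  then show ?case using extend_prefix[of j "extend_upto j Ss i" i] by fastforce
qed simp

lemma length_extend_upto: "length Ss \<le> length (extend_upto j Ss i)"
  using extend_upto_prefix[of j Ss i] by auto

lemma nth_extend_upto: "i' < length Ss \<Longrightarrow> extend_upto j Ss i ! i' = Ss ! i'"
  using extend_upto_prefix[of j Ss i] by (auto simp: nth_append)

lemma separated_extend:
  "separated Ss \<Longrightarrow> j < m \<Longrightarrow> i < length Ss \<Longrightarrow> separated (extend j Ss i)"
  using nth_mem[of i Ss] by (auto simp: separated_def extend_def Let_def)

lemma separated_extend_upto:
  "separated Ss \<Longrightarrow> j < m \<Longrightarrow> i \<le> length Ss \<Longrightarrow> separated (extend_upto j Ss i)"
  by (induction i) (use length_extend_upto[of Ss j] in \<open>auto intro!: separated_extend intro: less_le_trans Suc_le_lessD\<close>)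

lemma separated_reps: "j \<le> m \<Longrightarrow> separated (reps j)"
proof (induction j)
  case (Suc j)
  then show ?case using separated_extend_upto[of "reps j" j "length (reps j)"] by simp
qed (simp add: separated_def)

lemma extend_upto_sound:
  assumes "\<forall>S\<in>set Ss. S \<subseteq> {..<Suc j} \<and> vec W S 0 \<le> b" "i \<le> length Ss"
  shows "\<forall>S\<in>set (extend_upto j Ss i). S \<subseteq> {..<Suc j} \<and> vec W S 0 \<le> b"
  using assms(2)
proof (induction i)
  case (Suc i)
  have "extend_upto j Ss i ! i \<subseteq> {..<Suc j}"
    using Suc.prems assms(1) nth_extend_upto[of i Ss j i] by simp
  then show ?case
    using Suc by (auto simp: extend_def Let_def)
qed (use assms in simp)

lemma reps_sound: "\<forall>S\<in>set (reps j). S \<subseteq> {..<j} \<and> vec W S 0 \<le> b"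
proof (induction j)
  case (Suc j)
  then have "\<forall>S\<in>set (reps j). S \<subseteq> {..<Suc j} \<and> vec W S 0 \<le> b"
    by (meson lessThan_subset_iff le_SucI order_refl subset_trans)
  from extend_upto_sound[OF this order.refl] show ?case by (simp only: reps.simps)
qed (simp add: vec_def)

lemma reps_ne: "0 < length (reps j)"
proof (induction j)
  case (Suc j)
  then show ?case
    using length_extend_upto[of "reps j" j "length (reps j)"] unfolding reps.simps by linarith
qed simp

text \<open>At position \<open>i'\<close> the affordable extension is either appended or rejected
  because its profile is already present, and later steps only append.\<close>

lemma extend_upto_complete:
  assumes "i' < i" "i \<le> length Ss" "vec W (insert j (Ss ! i')) 0 \<le> b"
  shows "vecs W N (insert j (Ss ! i')) \<in> vecs W N ` set (extend_upto j Ss i)"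
  using assms
proof (induction i)
  case (Suc i)
  let ?E = "extend_upto j Ss i"
  have eq: "?E ! i = Ss ! i" using Suc.prems nth_extend_upto by simp
  have sub: "set ?E \<subseteq> set (extend j ?E i)"
    using extend_prefix[of j ?E i] by auto
  show ?case
  proof (cases "i' = i")
    case True
    then show ?thesis using Suc.prems eq by (auto simp: extend_def Let_def)
  next
    case False
    then show ?thesis using Suc sub by auto
  qed
qed simp

text \<open>Exchange argument: take \<open>j\<close> out of \<open>T\<close>, replace the rest by
  its listed representative and put \<open>j\<close> back. Neither set contains \<open>j\<close>
  before, so both profiles gain the same amount.\<close>

lemma reps_complete:
  "T \<subseteq> {..<j} \<Longrightarrow> vec W T 0 \<le> b \<Longrightarrow> vecs W N T \<in> vecs W N ` set (reps j)"
proof (induction j arbitrary: T)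
  case (Suc j)
  have fin: "finite T" using Suc.prems(1) finite_subset by blast
  have old: "set (reps j) \<subseteq> set (reps (Suc j))"
    using extend_upto_prefix[of j "reps j" "length (reps j)"] by auto
  show ?case
  proof (cases "j \<in> T")
    case False
    then have "T \<subseteq> {..<j}" using Suc.prems(1) by (auto simp: less_Suc_eq)
    then show ?thesis using Suc old by blast
  next
    case True
    define T' where "T' = T - {j}"
    have T: "T = insert j T'" "j \<notin> T'" "finite T'" using True fin by (auto simp: T'_def)
    have "vec W T' 0 \<le> b" using Suc.prems(2) T vec_insert[of T' j W 0] by simp
    moreover have "T' \<subseteq> {..<j}" using Suc.prems(1) T by (auto simp: less_Suc_eq)
    ultimately obtain S where S: "S \<in> set (reps j)" "vecs W N S = vecs W N T'"
      using Suc.IH[of T'] by (metis imageE)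
    then obtain i where i: "i < length (reps j)" "S = reps j ! i" by (metis in_set_conv_nth)
    have "finite S" "j \<notin> S"
      using S(1) reps_sound[of j] finite_subset[of S "{..<j}"] by auto
    then have eq: "vec W (insert j S) k = vec W T k" if "k < N" for k
      using S(2) T that by (simp add: vecs_eq_iff vec_insert)
    then have "vecs W N (insert j S) = vecs W N T" by (simp add: vecs_eq_iff)
    \<comment> \<open>The budget only concerns entry 0, which is part of the profile as
      \<open>N\<close> is positive; so the replacement is affordable too.\<close>
    moreover have "vec W (insert j S) 0 \<le> b" using eq[OF N] Suc.prems(2) by simp
    ultimately show ?thesis
      using extend_upto_complete[of i "length (reps j)" "reps j" j] i by simp
  qed
qed (simp add: vecs_eq_iff)

end

subsection \<open>Enumerating the profiles\<close>

text \<open>The candidate is built behind the last record. Accepting it just advances the end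
  pointer and the count; a rejected one is overwritten by the next.\<close>

definition insert_candidate :: com where
  "insert_candidate = candidate ;; dup_test ;; Blk [Sub 23 1 23] ;; When 23 (Blk [Add 6 6 7, Add 13 13 1])"

definition project_round :: com where
  "project_round = Blk [Read 10 8, LoadC 11 0, Add 11 11 5, LoadC 12 0, Add 12 12 13] ;;
     For 12 (insert_candidate ;; Blk [Add 11 11 7])"

definition main_loop :: com where
  "main_loop = For 9 (project_round ;; Blk [Add 8 8 1])"

text \<open>The matrix \<open>W\<close> starts at address \<open>z\<close>, the records start at
  \<open>l\<close>. Keeping \<open>X\<close> abstract separates the running time from the counting
  of profiles.\<close>

locale layout = table W N m b for W N m b +
  fixes z l X :: nat
  assumes z: "25 < z" and zl: "z + N * m \<le> l"
    and X: "\<And>Ss. separated Ss \<Longrightarrow> length Ss \<le> X"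
begin

abbreviation R :: nat where "R \<equiv> N + m"

definition base :: "mem \<Rightarrow> bool" where
  "base s \<longleftrightarrow> s 1 = 1 \<and> s 2 = N \<and> s 3 = m \<and> s 4 = b \<and> s 5 = l \<and> s 7 = R \<and>
     (\<forall>i<N. \<forall>j<m. s (z + i * m + j) = W i j)"

definition stores :: "mem \<Rightarrow> nat set list \<Rightarrow> bool" where
  "stores s Ss \<longleftrightarrow> s 13 = length Ss \<and> s 6 = l + length Ss * R \<and>
     (\<forall>q<length Ss. (\<forall>i<N. s (l + q * R + i) = vec W (Ss ! q) i) \<and>
        (\<forall>j<m. s (l + q * R + N + j) = of_bool (j \<in> Ss ! q)))"

section \<open>Address bounds and frame rules\<close>

lemma cell_less: "i < N \<Longrightarrow> j < m \<Longrightarrow> z + i * m + j < l"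
proof -
  assume "i < N" "j < m"
  then have "i * m + j < Suc i * m" by simp
  also have "\<dots> \<le> N * m" using \<open>i < N\<close> by (intro mult_le_mono) auto
  finally show ?thesis using zl by simp
qed

lemma base_cong:
  assumes "base s" "\<And>a. a \<in> {1, 2, 3, 4, 5, 7} \<or> z \<le> a \<and> a < l \<Longrightarrow> s' a = s a"
  shows "base s'"
  using assms cell_less unfolding base_def by (auto simp: add.assoc)

lemma record_less: "q < L \<Longrightarrow> i < R \<Longrightarrow> l + q * R + i < l + L * R"
proof -
  assume "q < L" "i < R"
  then have "q * R + i < Suc q * R" by simp
  also have "\<dots> \<le> L * R" using \<open>q < L\<close> by (intro mult_le_mono) auto
  finally show ?thesis by simp
qed

text \<open>Cells behind the last record are free, which is what allows a candidate to be built
  there.\<close>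

lemma stores_cong:
  assumes "stores s Ss" "\<And>a. a \<in> {6, 13} \<or> l \<le> a \<and> a < l + length Ss * R \<Longrightarrow> s' a = s a"
  shows "stores s' Ss"
proof -
  have *: "s' (l + q * R + i) = s (l + q * R + i)" if "q < length Ss" "i < R" for q i
    using assms(2) record_less[OF that] by simp
  have "s' (l + q * R + N + i) = s (l + q * R + N + i)" if "q < length Ss" "i < m" for q i
    using *[of q "N + i"] that by (simp add: add.assoc)
  then show ?thesis
    using assms * unfolding stores_def by simp
qed

text \<open>The bounds for \<open>candidate\<close> and for \<open>dup_test\<close> on at most
  \<open>X\<close> records, plus 4 steps for the acceptance.\<close>

definition insert_time :: nat where "insert_time = X * (12 * N + 15) + 8 * (N + m) + 11 * N + 28"

lemma wp_insert_candidate: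
  assumes base: "base s" and st: "stores s Ss" and sep: "separated Ss"
    and i: "i < length Ss" "Ss ! i \<subseteq> {..<j}" and j: "j < m"
    and reg: "s 8 = z + j" "s 9 = m - j" "s 10 = W 0 j" "s 11 = l + i * R"
  shows "wp insert_candidate insert_time (\<lambda>s'. base s' \<and> stores s' (extend j Ss i)
    \<and> (\<forall>a\<in>{8, 9, 10, 11, 12}. s' a = s a)) s"
proof -
  define L t where "L = length Ss" and "t = l + L * R"
  have LX: "L \<le> X" using X sep by (simp add: L_def)
  define S where "S = insert j (Ss ! i)"
  have l: "25 < l" and t: "25 < t" using z zl by (auto simp: t_def)
  have vecS: "vec W S k = vec W (Ss ! i) k + (if W k j = 0 then 0 else W 0 j)" for k
    using i(2) finite_subset[OF i(2)] unfolding S_def by (intro vec_insert) auto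
  define C where "C = (\<lambda>s1. (\<forall>k<N. s1 (t + k) = vec W S k) \<and> (\<forall>k<m. s1 (t + N + k) = of_bool (k \<in> S))
      \<and> (\<forall>a. a \<notin> {0, 14, 15, 16, 17, 18} \<longrightarrow> a < t \<longrightarrow> s1 a = s a))"
  define D where "D = (\<lambda>s2. (s2 23 = 0 \<longleftrightarrow> vec W S 0 \<le> b \<and> vecs W N S \<notin> vecs W N ` set Ss)
      \<and> (\<forall>k<N. s2 (t + k) = vec W S k) \<and> (\<forall>k<m. s2 (t + N + k) = of_bool (k \<in> S))
      \<and> (\<forall>a. a \<notin> {0, 14, 15, 16, 17, 18, 19, 20, 21, 22, 23} \<longrightarrow> a < t \<longrightarrow> s2 a = s a))"
  have 1: "wp candidate (8 * (N + m) + 11 * N + 17) C s"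
  proof (rule wp_post[OF wp_candidate[where N = N and m = m and t = t and z = "z + j" and j = j
          and v = "W 0 j" and p = "l + i * R"]])
    show "l + i * R + (N + m) \<le> t"
      using mult_le_mono1[of "Suc i" L R] i(1) by (simp add: t_def L_def)
    fix k assume "k < N"
    then show "z + j + k * m < t"
      using cell_less[of k j] j by (simp add: t_def)
  next
    fix s' assume *: "(\<forall>k<N. s' (t + k) = s (l + i * R + k) + (if s (z + j + k * m) = 0 then 0 else W 0 j)) \<and>
      (\<forall>k<m. s' (t + N + k) = (if k = j then 1 else s (l + i * R + N + k))) \<and>
      (\<forall>a. a \<notin> {0, 14, 15, 16, 17, 18} \<longrightarrow> a < t \<longrightarrow> s' a = s a)"
    have "s (z + j + k * m) = W k j" if "k < N" for k
      using base that j unfolding base_def by (metis add.assoc add.commute)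
    then show "C s'"
      using * st i(1) vecS unfolding C_def stores_def by (auto simp: S_def)
  qed (use base st j reg l z in \<open>auto simp: base_def stores_def t_def L_def\<close>)
  have 2: "wp dup_test (L * (12 * N + 15) + 7) D s1" if C: "C s1" for s1
  proof (rule wp_post[OF wp_dup[where N = N and b = b and l = l and t = t and R = R and L = L]])
    have "\<And>a. a \<in> {1, 2, 4, 5, 6, 7, 13} \<Longrightarrow> s1 a = s a"
      using C t unfolding C_def by auto
    then show "s1 1 = 1" "s1 2 = N" "s1 4 = b" "s1 5 = l" "s1 6 = t" "s1 7 = R" "s1 13 = L"
      using base st by (auto simp: base_def stores_def t_def L_def)
    fix s2 assume *: "(s2 23 = 0 \<longleftrightarrow> s1 t \<le> b \<and> (\<forall>q<L. \<exists>i<N. s1 (l + q * R + i) \<noteq> s1 (t + i))) \<and>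
      (\<forall>a. a \<notin> {0, 14, 15, 16, 17, 18, 19, 20, 21, 22, 23} \<longrightarrow> s2 a = s1 a)"
    have vt: "s1 t = vec W S 0" using C N unfolding C_def by (metis add_0_right)
    have old: "s1 (l + q * R + k) = vec W (Ss ! q) k" if "q < L" "k < N" for q k
    proof -
      have "s1 (l + q * R + k) = s (l + q * R + k)"
        using C record_less[of q L k] that l unfolding C_def t_def by simp
      then show ?thesis using st that unfolding stores_def L_def by simp
    qed
    have new: "s1 (t + k) = vec W S k" if "k < N" for k
      using C that unfolding C_def by blast
    have "(\<exists>i<N. s1 (l + q * R + i) \<noteq> s1 (t + i)) \<longleftrightarrow> vecs W N (Ss ! q) \<noteq> vecs W N S" if "q < L" for q
      unfolding vecs_eq_iff using old[OF that] new by (metis (no_types))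
    then have "(\<forall>q<L. \<exists>i<N. s1 (l + q * R + i) \<noteq> s1 (t + i)) \<longleftrightarrow>
        (\<forall>q<L. vecs W N (Ss ! q) \<noteq> vecs W N S)"
      by blast
    also have "\<dots> \<longleftrightarrow> vecs W N S \<notin> vecs W N ` set Ss"
      unfolding L_def by (auto simp: image_iff all_set_conv_all_nth)
    finally have "s2 23 = 0 \<longleftrightarrow> vec W S 0 \<le> b \<and> vecs W N S \<notin> vecs W N ` set Ss"
      using * vt by simp
    then show "D s2"
      using * C t unfolding C_def D_def by simp
  qed (use l t in auto)
  \<comment> \<open>Stated for every \<open>s'\<close> that differs from \<open>s2\<close> only in
    registers 6, 13 and 23, so that it serves both branches of the final
    \<open>When\<close>.\<close>
  have E: "base s' \<and> stores s' (extend j Ss i) \<and> (\<forall>a\<in>{8, 9, 10, 11, 12}. s' a = s a)"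
    if D: "D s2" and s': "\<And>a. a \<notin> {6, 13, 23} \<Longrightarrow> s' a = s2 a"
      "s' 6 = (if s2 23 = 0 then t + R else t)" "s' 13 = (if s2 23 = 0 then Suc L else L)" for s' s2
  proof -
    have frame: "s' a = s a" if "a \<notin> {0, 6, 13, 14, 15, 16, 17, 18, 19, 20, 21, 22, 23}" "a < t" for a
      using D s'(1)[of a] that unfolding D_def by auto
    have "base s'"
      using base by (rule base_cong) (use frame z t in \<open>auto simp: t_def\<close>)
    moreover have "stores s' (extend j Ss i)"
    proof (cases "s2 23 = 0")
      case True
      then have ext: "extend j Ss i = Ss @ [S]"
        using D unfolding D_def extend_def S_def Let_def by simp
      have old: "s' (l + q * R + k) = s (l + q * R + k)" if "q < L" "k < R" for q k
        using frame record_less[OF that] l unfolding t_def by simp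
      have old': "s' (l + q * R + N + k) = s (l + q * R + N + k)" if "q < L" "k < m" for q k
        using old[of q "N + k"] that by (simp add: add.assoc)
      have new: "\<forall>k<N. s' (t + k) = vec W S k" "\<forall>k<m. s' (t + N + k) = of_bool (k \<in> S)"
        using D s'(1) t unfolding D_def by simp_all
      show ?thesis
        unfolding ext stores_def
        using True s'(2,3) st old old' new
        by (simp add: stores_def L_def[symmetric] t_def[symmetric] less_Suc_eq nth_append)
    next
      case False
      then have "extend j Ss i = Ss"
        using D unfolding D_def extend_def S_def Let_def by auto
      moreover have "s 6 = t" "s 13 = L" using st by (auto simp: stores_def t_def L_def)
      ultimately show ?thesis
        using False frame l s'(2,3) by (auto intro!: stores_cong[OF st] simp: t_def L_def)
    qed
    ultimately show ?thesis using frame t by auto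
  qed
  define Q where "Q = (\<lambda>s'. base s' \<and> stores s' (extend j Ss i) \<and> (\<forall>a\<in>{8, 9, 10, 11, 12}. s' a = s a))"
  have 3: "wp (When 23 (Blk [Add 6 6 7, Add 13 13 1])) (2 + 1) Q (effs [Sub 23 1 23] s2)" if D: "D s2" for s2
  proof -
    have reg: "s2 1 = 1" "s2 6 = t" "s2 7 = R" "s2 13 = L"
      using D t base st unfolding D_def base_def stores_def by (auto simp: t_def L_def)
    have "Q (effs [Add 6 6 7, Add 13 13 1] (effs [Sub 23 1 23] s2))" if "s2 23 = 0"
      unfolding Q_def by (rule E[OF D]) (use reg that in auto)
    moreover have "Q (effs [Sub 23 1 23] s2)" if "s2 23 \<noteq> 0"
      unfolding Q_def by (rule E[OF D]) (use reg that in auto)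
    moreover have "effs [Sub 23 1 23] s2 23 = 0 \<longleftrightarrow> s2 23 \<noteq> 0"
      using reg by auto
    ultimately show ?thesis
      by (intro wp_When wp_Blk) (simp_all del: effs.simps)
  qed
  have "L * (12 * N + 15) \<le> X * (12 * N + 15)" using LX by (rule mult_le_mono1)
  then show ?thesis
    unfolding insert_candidate_def insert_time_def Q_def[symmetric]
    by (intro wp_Seq[OF 1 wp_Seq[OF 2 wp_Blk_Seq[OF _ 3 order.refl] order.refl]]) auto
qed

definition round_time :: nat where "round_time = X * (insert_time + 5) + 6"

lemma wp_project_round:
  assumes base: "base s" and st: "stores s Ss" and sep: "separated Ss"
    and Ss: "\<And>S. S \<in> set Ss \<Longrightarrow> S \<subseteq> {..<j}" and j: "j < m"
    and reg: "s 8 = z + j" "s 9 = m - j"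
  shows "wp project_round round_time (\<lambda>s'. base s' \<and> stores s' (extend_upto j Ss (length Ss))
    \<and> s' 8 = z + j \<and> s' 9 = m - j) s"
proof -
  have l: "25 < l" using z zl by simp
  define I where "I = (\<lambda>i s'. base s' \<and> stores s' (extend_upto j Ss i) \<and> s' 8 = z + j \<and> s' 9 = m - j
    \<and> s' 10 = W 0 j \<and> s' 11 = l + i * R)"
  have body: "wp (insert_candidate ;; Blk [Add 11 11 7]) (insert_time + 1)
      (\<lambda>s''. s'' 12 = length Ss - i \<and> s'' 1 = 1 \<and> I (Suc i) (s''(12 := length Ss - Suc i, 0 := 0))) s'"
    if i: "i < length Ss" and I: "I i s'" and c: "s' 12 = length Ss - i" for i s'
  proof (rule wp_Seq[OF wp_insert_candidate[where Ss = "extend_upto j Ss i" and i = i and j = j]])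
    show "separated (extend_upto j Ss i)" using separated_extend_upto[OF sep j] i by simp
    show "i < length (extend_upto j Ss i)" using length_extend_upto[of Ss j i] i by simp
    show "extend_upto j Ss i ! i \<subseteq> {..<j}" using nth_extend_upto[OF i] Ss i by simp
    fix s1 assume *: "base s1 \<and> stores s1 (extend j (extend_upto j Ss i) i) \<and> (\<forall>a\<in>{8, 9, 10, 11, 12}. s1 a = s' a)"
    let ?s2 = "(effs [Add 11 11 7] s1)(12 := length Ss - Suc i, 0 := 0)"
    have "base ?s2" by (rule base_cong[of s1]) (use * z l in auto)
    moreover have "stores ?s2 (extend_upto j Ss (Suc i))"
      unfolding extend_upto_Suc by (rule stores_cong[of s1]) (use * l in auto)
    moreover have "s1 1 = 1" "s1 7 = R" using * unfolding base_def by auto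
    ultimately show "wp (Blk [Add 11 11 7]) 1
        (\<lambda>s''. s'' 12 = length Ss - i \<and> s'' 1 = 1 \<and> I (Suc i) (s''(12 := length Ss - Suc i, 0 := 0))) s1"
      using * I c by (intro wp_Blk) (auto simp: I_def)
  qed (use I j in \<open>auto simp: I_def\<close>)
  let ?pre = "[Read 10 8, LoadC 11 0, Add 11 11 5, LoadC 12 0, Add 12 12 13]"
  have "base (effs ?pre s)" by (rule base_cong[OF base]) (use z l in auto)
  moreover have "stores (effs ?pre s) Ss" by (rule stores_cong[OF st]) (use l in auto)
  \<comment> \<open>Register 8 addresses column \<open>j\<close> of row 0, the row of costs, so
    reading through it loads the cost of \<open>j\<close>.\<close>
  moreover have "s (z + 0 * m + j) = W 0 j"
    using base N j unfolding base_def by blast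
  moreover have "s 5 = l" "s 13 = length Ss"
    using base st unfolding base_def stores_def by auto
  ultimately have init: "I 0 (effs ?pre s)" "effs ?pre s 12 = length Ss"
    using reg unfolding I_def by auto
  have "length Ss * (insert_time + 1 + 4) + 1 \<le> X * (insert_time + 5) + 1"
    using mult_le_mono1[OF X[OF sep], of "insert_time + 5"] by (simp add: add.commute)
  then have "wp (For 12 (insert_candidate ;; Blk [Add 11 11 7])) (X * (insert_time + 5) + 1)
     (\<lambda>s'. base s' \<and> stores s' (extend_upto j Ss (length Ss)) \<and> s' 8 = z + j \<and> s' 9 = m - j) (effs ?pre s)"
    by (intro wp_For[where I = I and s = "effs ?pre s" and N = "length Ss", OF _ init body])
      (auto simp: I_def)
  then show ?thesis
    unfolding project_round_def round_time_def by (rule wp_Blk_Seq[rotated]) auto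
qed

lemma wp_main_loop:
  assumes base: "base s" and st: "stores s [{}]" and reg: "s 8 = z" "s 9 = m"
  shows "wp main_loop (m * (round_time + 5) + 1) (\<lambda>s'. base s' \<and> stores s' (reps m)) s"
proof -
  have l: "25 < l" using z zl by simp
  define I where "I = (\<lambda>j s'. base s' \<and> stores s' (reps j) \<and> s' 8 = z + j)"
  have body: "wp (project_round ;; Blk [Add 8 8 1]) (round_time + 1)
      (\<lambda>s''. s'' 9 = m - j \<and> s'' 1 = 1 \<and> I (Suc j) (s''(9 := m - Suc j, 0 := 0))) s'"
    if j: "j < m" and I: "I j s'" and c: "s' 9 = m - j" for j s'
  proof (rule wp_Seq[OF wp_project_round[where Ss = "reps j" and j = j]])
    fix s1 assume *: "base s1 \<and> stores s1 (extend_upto j (reps j) (length (reps j))) \<and> s1 8 = z + j \<and> s1 9 = m - j"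
    let ?s2 = "(effs [Add 8 8 1] s1)(9 := m - Suc j, 0 := 0)"
    have "base ?s2" by (rule base_cong[of s1]) (use * z l in auto)
    moreover have "stores ?s2 (reps (Suc j))"
      unfolding reps.simps by (rule stores_cong[of s1]) (use * l in auto)
    moreover have "s1 1 = 1" using * unfolding base_def by auto
    ultimately show "wp (Blk [Add 8 8 1]) 1
        (\<lambda>s''. s'' 9 = m - j \<and> s'' 1 = 1 \<and> I (Suc j) (s''(9 := m - Suc j, 0 := 0))) s1"
      using * by (intro wp_Blk) (auto simp: I_def)
  qed (use I j c reps_sound separated_reps in \<open>auto simp: I_def\<close>)
  show ?thesis
    unfolding main_loop_def
    by (rule wp_For[where I = I and N = m and T = "round_time + 1", OF _ _ _ body])
      (use base st reg in \<open>auto simp: I_def\<close>)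
qed

end

subsection \<open>Input and output\<close>

text \<open>The input occupies the registers, and only register 0 (the input length) is known, so the
  cells 1 to 25 are saved at address 32 times the length before any of them is used.
  The output, in turn, overwrites the registers last: \<open>m\<close> is stored at twice the address \<open>x\<close> of the
  first output bit, so that register 0, pointing to \<open>x\<close>, only has to be doubled to fetch it.\<close>

definition save_regs :: "instr list" where
  "save_regs = replicate 5 (Add 0 0 0) @ [Write 0 1, LoadC 1 1] @
     concat (map (\<lambda>i. [Add 0 0 1, Write 0 i]) [2..<26])"

lemma effs_save_loop:
  assumes "s 1 = 1" "k + 2 \<le> s 0"
  shows "effs (concat (map (\<lambda>i. [Add 0 0 1, Write 0 i]) [2..<k + 2])) s =
    (\<lambda>a. if a = 0 then s 0 + k else if s 0 < a \<and> a \<le> s 0 + k then s (a + 1 - s 0) else s a)"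
  using assms(2)
proof (induction k)
  case (Suc k)
  define t where "t = (\<lambda>a. if a = 0 then s 0 + k else if s 0 < a \<and> a \<le> s 0 + k then s (a + 1 - s 0) else s a)"
  have "effs (concat (map (\<lambda>i. [Add 0 0 1, Write 0 i]) [2..<Suc k + 2])) s = effs [Add 0 0 1, Write 0 (k + 2)] t"
    using Suc by (simp add: effs_append t_def)
  also have "\<dots> = t(0 := s 0 + Suc k, s 0 + Suc k := s (k + 2))"
    using Suc.prems assms(1) by (simp add: t_def)
  also have "\<dots> = (\<lambda>a. if a = 0 then s 0 + Suc k else if s 0 < a \<and> a \<le> s 0 + Suc k then s (a + 1 - s 0) else s a)"
  proof
    fix a
    show "(t(0 := s 0 + Suc k, s 0 + Suc k := s (k + 2))) a =
        (if a = 0 then s 0 + Suc k else if s 0 < a \<and> a \<le> s 0 + Suc k then s (a + 1 - s 0) else s a)"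
      by (cases "a = s 0 + Suc k") (auto simp: t_def)
  qed
  finally show ?case .
qed auto

text \<open>Five doublings lead beyond the input and, as the length is at least 3, beyond the
  registers. Register 1 is saved first, because the other stores need the constant 1 to advance the
  address in register 0.\<close>

lemma effs_save_regs:
  assumes "3 \<le> s 0"
  shows "effs save_regs s = (\<lambda>a. if a = 0 then 32 * s 0 + 24 else if a = 1 then 1
    else if 32 * s 0 \<le> a \<and> a \<le> 32 * s 0 + 24 then s (a + 1 - 32 * s 0) else s a)"
proof -
  let ?s = "s(0 := 32 * s 0, 32 * s 0 := s 1, 1 := 1)"
  have eq: "effs (replicate 5 (Add 0 0 0) @ [Write 0 1, LoadC 1 1]) s = ?s"
    using assms by (auto simp: numeral_eq_Suc fun_eq_iff)
  have "(24::nat) + 2 = 26" by simp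
  then have "effs save_regs s = effs (concat (map (\<lambda>i. [Add 0 0 1, Write 0 i]) [2..<24 + 2])) ?s"
    using effs_append[of "replicate 5 (Add 0 0 0) @ [Write 0 1, LoadC 1 1]"
        "concat (map (\<lambda>i. [Add 0 0 1, Write 0 i]) [2..<26])" s]
    unfolding save_regs_def append_assoc eq by (simp only:)
  also have "\<dots> =
    (\<lambda>a. if a = 0 then ?s 0 + 24 else if ?s 0 < a \<and> a \<le> ?s 0 + 24 then ?s (a + 1 - ?s 0) else ?s a)"
    by (rule effs_save_loop) (use assms in auto)
  also have "\<dots> = (\<lambda>a. if a = 0 then 32 * s 0 + 24 else if a = 1 then 1
    else if 32 * s 0 \<le> a \<and> a \<le> 32 * s 0 + 24 then s (a + 1 - 32 * s 0) else s a)"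
  proof
    fix a
    show "(if a = 0 then ?s 0 + 24 else if ?s 0 < a \<and> a \<le> ?s 0 + 24 then ?s (a + 1 - ?s 0) else ?s a) =
      (if a = 0 then 32 * s 0 + 24 else if a = 1 then 1
       else if 32 * s 0 \<le> a \<and> a \<le> 32 * s 0 + 24 then s (a + 1 - 32 * s 0) else s a)"
      using assms by (cases "a = 32 * s 0") auto
  qed
  finally show ?thesis .
qed

text \<open>With \<open>B\<close> for 32 times the length, register 0 holds \<open>B + 24\<close>,
  the address of the last saved cell; this explains 24 for \<open>B\<close> itself and 50 for the
  number \<open>B - 26\<close> of cells to copy. The length is lost by now, so all cells from 26 up
  to \<open>B - 1\<close> are copied; those beyond the input are 0. \<open>Sub 9 1 3\<close> is
  nonzero only for \<open>m = 0\<close>.\<close>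

definition setup_code :: com where
  "setup_code =
     Blk (save_regs @ [LoadC 8 24, Sub 8 0 8, LoadC 14 26, Add 15 0 1, LoadC 16 50, Sub 16 0 16]) ;;
     copy_loop ;;
     Blk [Read 2 8, Add 8 8 1, Read 3 8, Add 8 8 1, Read 4 8, Add 8 8 1, Add 5 8 8, Sub 9 1 3] ;;
     When 9 (Blk [LoadC 2 0]) ;;
     Blk [Add 2 2 1, Add 7 2 3, Add 6 5 7, LoadC 9 0, Add 9 9 3, LoadC 13 0, Add 13 13 1]"

lemma length_save_regs: "length save_regs = 55"
  by (simp add: save_regs_def upt_rec)

lemma straight_save_regs: "list_all straight save_regs"
  by (simp add: save_regs_def list_all_iff)

text \<open>The last conjunct provides the first record: the empty set has a zero profile and a zero
  characteristic vector, so untouched memory already represents it.\<close>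

lemma wp_setup:
  fixes xs :: "nat list"
  defines "len \<equiv> length xs" and "s \<equiv> snd (init_conf xs)"
  assumes len: "3 \<le> len" and T: "256 * len + 100 \<le> T"
  shows "wp setup_code T (\<lambda>s'.
    s' 1 = 1 \<and> s' 2 = (if xs ! 1 = 0 then 1 else Suc (xs ! 0)) \<and> s' 3 = xs ! 1 \<and> s' 4 = xs ! 2
    \<and> s' 5 = 64 * len + 6 \<and> s' 7 = s' 2 + s' 3 \<and> s' 6 = s' 5 + s' 7
    \<and> s' 8 = 32 * len + 3 \<and> s' 9 = xs ! 1 \<and> s' 13 = 1
    \<and> (\<forall>a<len. s' (32 * len + a) = xs ! a) \<and> (\<forall>a\<ge>64 * len + 6. s' a = 0)) s"
proof -
  define B where "B = 32 * len"
  have B: "96 \<le> B" "len \<le> B" using len by (simp_all add: B_def)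
  have s: "s 0 = len" "\<And>a. a < len \<Longrightarrow> s (Suc a) = xs ! a" "\<And>a. len < a \<Longrightarrow> s a = 0"
    by (auto simp: s_def len_def init_conf_def)
  define C where "C = (\<lambda>s1. s1 1 = 1 \<and> s1 8 = B \<and> (\<forall>a<len. s1 (B + a) = xs ! a) \<and> (\<forall>a\<ge>2 * B. s1 a = 0))"
  let ?blk = "[LoadC 8 24, Sub 8 0 8, LoadC 14 26, Add 15 0 1, LoadC 16 50, Sub 16 0 16]"
  define s0 where "s0 = effs (save_regs @ ?blk) s"
  define \<sigma> where "\<sigma> = effs save_regs s"
  have \<sigma>: "\<sigma> a = (if a = 0 then B + 24 else if a = 1 then 1
    else if B \<le> a \<and> a \<le> B + 24 then s (a + 1 - B) else s a)" for a
    unfolding \<sigma>_def using effs_save_regs[of s] len s(1) by (simp add: B_def)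
  have "\<sigma> 0 = B + 24" "\<sigma> 1 = 1" by (simp_all add: \<sigma>)
  then have s0: "s0 = \<sigma>(8 := B, 14 := 26, 15 := B + 25, 16 := B - 26)"
    unfolding s0_def effs_append \<sigma>_def[symmetric] by (simp add: add.commute)
  have reg: "s0 1 = 1" "s0 8 = B" "s0 14 = 26" "s0 15 = B + 25" "s0 16 = B - 26"
    by (simp_all add: s0 \<sigma>)
  have low: "s0 (B + a) = s (Suc a)" if "a < 25" for a
    using that B by (simp add: s0 \<sigma>)
  have mid: "s0 a = s a" if "25 < a" "a < B" for a
    using that by (simp add: s0 \<sigma>)
  have high: "s0 a = 0" if "2 * B \<le> a" for a
    using that B s(3)[of a] by (simp add: s0 \<sigma>)
  have 1: "wp copy_loop (8 * B + 1) C s0"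
  proof (rule wp_post[OF wp_copy[where s = s0 and p = 26 and w = "B + 25" and N = "B - 26"]])
    fix s1
    assume *: "(\<forall>i<B - 26. s1 (B + 25 + i) = s0 (26 + i)) \<and> s1 14 = 26 + (B - 26) \<and>
      s1 15 = B + 25 + (B - 26) \<and>
      (\<forall>a. a \<notin> {0, 14, 15, 16, 17} \<longrightarrow> a < B + 25 \<or> B + 25 + (B - 26) \<le> a \<longrightarrow> s1 a = s0 a)"
    then have copied: "s1 (B + 25 + i) = s0 (26 + i)" if "i < B - 26" for i
      using that by blast
    have frame: "s1 a = s0 a" if "17 < a \<or> a = 1 \<or> a = 8" "a < B + 25 \<or> 2 * B - 1 \<le> a" for a
    proof -
      have d: "a < B + 25 \<or> B + 25 + (B - 26) \<le> a" using that(2) B by linarith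
      have n: "a \<notin> {0, 14, 15, 16, 17}" using that(1) by auto
      show ?thesis
        by (rule *[THEN conjunct2, THEN conjunct2, THEN conjunct2, rule_format, OF n d])
    qed
    have "s1 1 = 1" "s1 8 = B" using frame[of 1] frame[of 8] reg B by simp_all
    moreover have "s1 a = 0" if "2 * B \<le> a" for a
      using frame[of a] high[OF that] that B by simp
    moreover have "s1 (B + a) = xs ! a" if "a < len" for a
    proof (cases "a < 25")
      case True
      then show ?thesis using frame[of "B + a"] low[of a] s(2)[OF that] B by simp
    next
      case False
      have "Suc a < B" using that B by (simp add: B_def)
      moreover have "B + 25 + (a - 25) = B + a" "26 + (a - 25) = Suc a" using False by auto
      ultimately show ?thesis
        using copied[of "a - 25"] mid[of "Suc a"] s(2)[OF that] False by simp
    qed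
    ultimately show "C s1" unfolding C_def by blast
  qed (use B reg in auto)
  let ?blk2 = "[Read 2 8, Add 8 8 1, Read 3 8, Add 8 8 1, Read 4 8, Add 8 8 1, Add 5 8 8, Sub 9 1 3]"
  define D where "D = (\<lambda>s'. s' 1 = 1 \<and> s' 2 = (if xs ! 1 = 0 then 0 else xs ! 0) \<and> s' 3 = xs ! 1 \<and> s' 4 = xs ! 2
    \<and> s' 5 = 2 * B + 6 \<and> s' 8 = B + 3
    \<and> (\<forall>a<len. s' (B + a) = xs ! a) \<and> (\<forall>a\<ge>2 * B + 6. s' a = 0))"
  have 2: "wp (When 9 (Blk [LoadC 2 0])) (1 + 1) D (effs ?blk2 s1)" if C: "C s1" for s1
  proof -
    have cell: "s1 (B + a) = xs ! a" if "a < len" for a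
      using C that unfolding C_def by auto
    have "s1 1 = 1" "s1 8 = B" using C unfolding C_def by auto
    moreover have "s1 B = xs ! 0" "s1 (Suc B) = xs ! 1" "s1 (Suc (Suc B)) = xs ! 2"
      using cell[of 0] cell[of 1] cell[of 2] len by simp_all
    moreover have B3: "B + 3 = Suc (Suc (Suc B))" "2 * B + 6 = Suc (Suc (Suc B)) + Suc (Suc (Suc B))"
      by simp_all
    moreover define s2 where
      "s2 = s1(2 := xs ! 0, 3 := xs ! 1, 4 := xs ! 2, 8 := B + 3, 5 := 2 * B + 6, 9 := 1 - xs ! 1)"
    ultimately have eq: "effs ?blk2 s1 = s2"
      using B by (simp add: B3)
    have "s2 9 = 0 \<longleftrightarrow> xs ! 1 \<noteq> 0" by (auto simp: s2_def)
    moreover have "D (s2(2 := 0))" if "xs ! 1 = 0"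
      using C B that unfolding C_def D_def s2_def by simp
    moreover have "D s2" if "xs ! 1 \<noteq> 0"
      using C B that unfolding C_def D_def s2_def by simp
    ultimately show ?thesis
      unfolding eq by (intro wp_When wp_Blk) auto
  qed
  have 3: "wp (Blk [Add 2 2 1, Add 7 2 3, Add 6 5 7, LoadC 9 0, Add 9 9 3, LoadC 13 0, Add 13 13 1]) 7
    (\<lambda>s'. s' 1 = 1 \<and> s' 2 = (if xs ! 1 = 0 then 1 else Suc (xs ! 0)) \<and> s' 3 = xs ! 1 \<and> s' 4 = xs ! 2
    \<and> s' 5 = 64 * len + 6 \<and> s' 7 = s' 2 + s' 3 \<and> s' 6 = s' 5 + s' 7
    \<and> s' 8 = 32 * len + 3 \<and> s' 9 = xs ! 1 \<and> s' 13 = 1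
    \<and> (\<forall>a<len. s' (32 * len + a) = xs ! a) \<and> (\<forall>a\<ge>64 * len + 6. s' a = 0)) s2" if "D s2" for s2
    using that B by (intro wp_Blk) (auto simp: D_def B_def)
  show ?thesis
    unfolding setup_code_def
    by (rule wp_Blk_Seq[OF _ wp_Seq[OF 1[unfolded s0_def] wp_Blk_Seq[OF _ wp_Seq[OF 2 3 order.refl] order.refl] order.refl]])
      (use T in \<open>auto simp: straight_save_regs length_save_regs B_def\<close>)
qed

definition output_code :: com where
  "output_code =
     Blk [Add 19 25 2, Add 18 19 19, Write 18 3, LoadC 14 25, Add 14 14 19, LoadC 15 26,
       LoadC 16 25, Sub 16 3 16] ;;
     copy_loop ;;
     Blk ([LoadC 0 24, Add 0 0 19] @ concat (map (\<lambda>i. [Read i 0, Sub 0 0 1]) (rev [2..<26])) @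
       [Read 1 0, Add 0 0 0, Read 0 0])"

text \<open>Loading downwards leaves register 0 at \<open>x\<close>, and register 1, which supplies
  the decrement, can be overwritten after all others.\<close>

lemma effs_load_regs:
  assumes "s 1 = 1" "s 0 = x + k" "k + 2 < x"
  shows "effs (concat (map (\<lambda>i. [Read i 0, Sub 0 0 1]) (rev [2..<k + 2]))) s =
    (\<lambda>a. if a = 0 then x else if 2 \<le> a \<and> a < k + 2 then s (x + a - 1) else s a)"
  using assms
proof (induction k arbitrary: s)
  case (Suc k)
  define s' where "s' = s(k + 2 := s (x + Suc k), 0 := x + k)"
  have "effs (concat (map (\<lambda>i. [Read i 0, Sub 0 0 1]) (rev [2..<Suc k + 2]))) s =
      effs (concat (map (\<lambda>i. [Read i 0, Sub 0 0 1]) (rev [2..<k + 2]))) s'"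
    using Suc.prems by (simp add: s'_def)
  also have "\<dots> = (\<lambda>a. if a = 0 then x else if 2 \<le> a \<and> a < k + 2 then s' (x + a - 1) else s' a)"
    by (rule Suc.IH) (use Suc.prems in \<open>auto simp: s'_def\<close>)
  also have "\<dots> = (\<lambda>a. if a = 0 then x else if 2 \<le> a \<and> a < Suc k + 2 then s (x + a - 1) else s a)"
  proof
    fix a
    show "(if a = 0 then x else if 2 \<le> a \<and> a < k + 2 then s' (x + a - 1) else s' a) =
        (if a = 0 then x else if 2 \<le> a \<and> a < Suc k + 2 then s (x + a - 1) else s a)"
      using Suc.prems by (cases "a = k + 2") (auto simp: s'_def)
  qed
  finally show ?case .
qed (auto simp: fun_eq_iff)

lemma wp_output:
  assumes "s 1 = 1" "s 2 = N" "s 3 = m" "s 25 = p" "26 < p" "m < p" "8 * m + 70 \<le> T"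
  shows "wp output_code T (\<lambda>s'. s' 0 = m \<and> (\<forall>j<m. s' (Suc j) = s (p + N + j))) s"
proof -
  define x where "x = p + N"
  \<comment> \<open>\<open>m < x\<close> keeps the output cells up to \<open>m\<close> as well as
    the cell \<open>2 * x\<close> apart from the bits stored at \<open>x\<close> to
    \<open>x + m - 1\<close>.\<close>
  have x: "26 < x" "m < x" using assms by (auto simp: x_def)
  define C where "C = (\<lambda>s1. s1 1 = 1 \<and> s1 19 = x \<and> s1 (2 * x) = m \<and> (\<forall>j<m. s1 (x + j) = s (x + j))
    \<and> (\<forall>j<m. 25 \<le> j \<longrightarrow> s1 (Suc j) = s (x + j)))"
  let ?blk = "[Add 19 25 2, Add 18 19 19, Write 18 3, LoadC 14 25, Add 14 14 19, LoadC 15 26,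
       LoadC 16 25, Sub 16 3 16]"
  define s0 where "s0 = effs ?blk s"
  have "s 25 + s 2 = x" using assms by (simp add: x_def)
  then have s0: "s0 = s(19 := x, 18 := 2 * x, 2 * x := m, 14 := x + 25, 15 := 26, 16 := m - 25)"
    unfolding s0_def using assms x by (simp add: mult_2 add.commute)
  have reg: "s0 1 = 1" "s0 14 = x + 25" "s0 15 = 26" "s0 16 = m - 25" "s0 19 = x" "s0 (2 * x) = m"
    using assms x by (simp_all add: s0)
  have heap: "s0 (x + j) = s (x + j)" if "j < m" for j
    using that x by (simp add: s0)
  have 1: "wp copy_loop (8 * m + 1) C s0"
  proof (rule wp_post[OF wp_copy[where s = s0 and p = "x + 25" and w = 26 and N = "m - 25"]])
    fix s1 assume *: "(\<forall>i<m - 25. s1 (26 + i) = s0 (x + 25 + i)) \<and> s1 14 = x + 25 + (m - 25) \<and>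
      s1 15 = 26 + (m - 25) \<and>
      (\<forall>a. a \<notin> {0, 14, 15, 16, 17} \<longrightarrow> a < 26 \<or> 26 + (m - 25) \<le> a \<longrightarrow> s1 a = s0 a)"
    then have copied: "s1 (26 + i) = s0 (x + 25 + i)" if "i < m - 25" for i
      using that by blast
    have frame: "s1 a = s0 a" if "a = 1 \<or> a = 19 \<or> x \<le> a" for a
    proof -
      have d: "a < 26 \<or> 26 + (m - 25) \<le> a" using that x by linarith
      have n: "a \<notin> {0, 14, 15, 16, 17}" using that x by auto
      show ?thesis
        by (rule *[THEN conjunct2, THEN conjunct2, THEN conjunct2, rule_format, OF n d])
    qed
    have "s1 1 = 1" "s1 19 = x" "s1 (2 * x) = m"
      using frame[of 1] frame[of 19] frame[of "2 * x"] reg by simp_all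
    moreover have "s1 (x + j) = s (x + j)" if "j < m" for j
      using frame[of "x + j"] heap[OF that] by simp
    moreover have "s1 (Suc j) = s (x + j)" if "j < m" "25 \<le> j" for j
    proof -
      have "26 + (j - 25) = Suc j" "x + 25 + (j - 25) = x + j" using that by auto
      then show ?thesis using copied[of "j - 25"] heap[of j] that by simp
    qed
    ultimately show "C s1" unfolding C_def by blast
  qed (use x reg in auto)
  let ?load = "concat (map (\<lambda>i. [Read i 0, Sub 0 0 1]) (rev [2..<26]))"
  have 2: "wp (Blk ([LoadC 0 24, Add 0 0 19] @ ?load @ [Read 1 0, Add 0 0 0, Read 0 0])) 60
     (\<lambda>s'. s' 0 = m \<and> (\<forall>j<m. s' (Suc j) = s (x + j))) s1" if C: "C s1" for s1
  proof (rule wp_Blk)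
    define \<tau> where "\<tau> = effs ?load (s1(0 := x + 24))"
    have pre: "effs [LoadC 0 24, Add 0 0 19] s1 = s1(0 := x + 24)"
      using C by (simp add: C_def add.commute)
    have "(24::nat) + 2 = 26" by simp
    then have \<tau>: "\<tau> a = (if a = 0 then x else if 2 \<le> a \<and> a < 26 then s1 (x + a - 1) else s1 a)" for a
      using effs_load_regs[of "s1(0 := x + 24)" x 24] C x by (simp add: \<tau>_def C_def)
    have \<tau>_reg: "\<tau> 0 = x" "\<tau> (2 * x) = m"
      using C x by (simp_all add: \<tau> C_def)
    have \<tau>_heap: "\<tau> (x + j) = s (x + j)" if "j < m" for j
      using C x that by (simp add: \<tau> C_def)
    have \<tau>_out: "\<tau> (Suc j) = s (x + j)" if "j < m" "0 < j" for j
      using C x that by (auto simp: \<tau> C_def)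
    have "effs [Read 1 0, Add 0 0 0, Read 0 0] \<tau> = \<tau>(1 := \<tau> x, 0 := m)"
      using \<tau>_reg x by (simp add: mult_2[symmetric] fun_upd_twist)
    then have eq: "effs ([LoadC 0 24, Add 0 0 19] @ ?load @ [Read 1 0, Add 0 0 0, Read 0 0]) s1 = \<tau>(1 := \<tau> x, 0 := m)"
      unfolding effs_append pre \<tau>_def[symmetric] .
    have "(\<tau>(1 := \<tau> x, 0 := m)) (Suc j) = s (x + j)" if "j < m" for j
      using \<tau>_heap[of 0] \<tau>_out[of j] that by (cases j) auto
    then show "effs ([LoadC 0 24, Add 0 0 19] @ ?load @ [Read 1 0, Add 0 0 0, Read 0 0]) s1 0 = m \<and>
      (\<forall>j<m. effs ([LoadC 0 24, Add 0 0 19] @ ?load @ [Read 1 0, Add 0 0 0, Read 0 0]) s1 (Suc j) = s (x + j))"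
      unfolding eq by auto
    show "list_all straight ([LoadC 0 24, Add 0 0 19] @ ?load @ [Read 1 0, Add 0 0 0, Read 0 0])"
      by (simp add: list_all_iff)
    have "length ?load = 48" by (simp add: upt_rec)
    then show "length ([LoadC 0 24, Add 0 0 19] @ ?load @ [Read 1 0, Add 0 0 0, Read 0 0]) \<le> 60" by simp
  qed
  show ?thesis
    unfolding output_code_def x_def[symmetric]
    by (rule wp_Blk_Seq[OF _ wp_Seq[OF 1[unfolded s0_def] 2 order.refl]])
      (use assms in auto)
qed

subsection \<open>Correctness and running time\<close>

text \<open>The encoding lists the costs directly before the votes and with the same row length, so
  together they form one matrix, with the costs as row 0.\<close>

definition rows :: "(nat \<Rightarrow> nat) \<Rightarrow> (nat \<Rightarrow> nat set) \<Rightarrow> nat \<Rightarrow> nat \<Rightarrow> nat" where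
  "rows c A i j = (case i of 0 \<Rightarrow> c j | Suc v \<Rightarrow> of_bool (j \<in> A v))"

lemma vec_rows_0: "vec (rows c A) S 0 = set_cost c S"
  by (auto simp: vec_def rows_def set_cost_def intro!: sum.cong)

lemma vec_rows_Suc: "finite S \<Longrightarrow> vec (rows c A) S (Suc i) = utility c A i S"
  by (auto simp: vec_def rows_def utility_def set_cost_def sum.inter_restrict intro!: sum.cong)

lemma length_grid: "length (concat (map (\<lambda>i. map (f i) [0..<m]) [0..<n])) = n * m"
  by (induction n) auto

lemma nth_grid:
  assumes "i < n" "j < m"
  shows "concat (map (\<lambda>i. map (f i) [0..<m]) [0..<n]) ! (i * m + j) = f i j"
  using assms(1)
proof (induction n)
  case (Suc n)
  show ?case
  proof (cases "i < n")
    case True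
    then have "i * m + j < n * m"
      using mult_le_mono1[of "Suc i" n m] assms(2) by simp
    then show ?thesis using Suc.IH[OF True] by (simp add: nth_append length_grid)
  next
    case False
    then have "i = n" using Suc.prems by simp
    then show ?thesis using assms(2) by (simp add: nth_append length_grid)
  qed
qed simp

lemma length_encode: "length (encode_instance n m c b A) = 3 + m + n * m"
  by (simp add: encode_instance_def length_grid)

lemma encode_header:
  "encode_instance n m c b A ! 0 = n" "encode_instance n m c b A ! 1 = m"
  "encode_instance n m c b A ! 2 = b"
  by (simp_all add: encode_instance_def)

lemma encode_rows:
  assumes "i < Suc n" "j < m"
  shows "encode_instance n m c b A ! (3 + i * m + j) = rows c A i j"
proof (cases i)
  case 0
  then show ?thesis using assms by (simp add: encode_instance_def nth_append rows_def)
next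
  case (Suc v)
  then have "encode_instance n m c b A ! (3 + i * m + j) =
      concat (map (\<lambda>i. map (\<lambda>j. if j \<in> A i then 1 else 0) [0..<m]) [0..<n]) ! (v * m + j)"
    by (simp add: encode_instance_def nth_append)
  also have "\<dots> = (if j \<in> A v then 1 else 0)"
    using nth_grid[of v n j m "\<lambda>i j. if j \<in> A i then 1 else 0"] assms Suc by simp
  finally show ?thesis using Suc by (simp add: rows_def)
qed

lemma length_le_input_size: "length xs \<le> input_size xs"
  by (induction xs) (auto simp: input_size_def)

text \<open>The profile factors through \<open>h\<close>, which has one entry per distinct vote
  instead of one per voter and measures costs in units of \<open>g\<close>. The functions from
  \<open>D\<close> to \<open>{..m * d}\<close> are then counted.\<close>

lemma card_profiles:
  assumes Z: "\<And>S. S \<in> Z \<Longrightarrow> S \<subseteq> {..<m}" and N: "N \<le> Suc n"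
    and k: "distinct_votes n A \<le> k" and d: "scalable_limit m c b \<le> d"
  shows "card (vecs (rows c A) N ` Z) \<le> (m * d + 1) ^ (k + 1)"
proof -
  define g where "g = Gcd (c ` {..<m} \<union> {b})"
  \<comment> \<open>If all costs and the budget are 0, then \<open>g = 0\<close> and the quotient is
    0, so both claims still hold.\<close>
  have c: "c j = g * (c j div g)" "c j div g \<le> d" if "j < m" for j
  proof -
    have "g dvd c j" unfolding g_def using that by (intro Gcd_dvd) auto
    then show "c j = g * (c j div g)" by simp
    have "c j \<le> Max (c ` {..<m} \<union> {0})" using that by (intro Max_ge) auto
    then show "c j div g \<le> d"
      using d div_le_mono[of "c j" _ g] unfolding scalable_limit_def g_def by (meson le_trans)
  qed
  \<comment> \<open>\<open>UNIV\<close> stands for the cost row: its utility is the whole cost. It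
    accounts for the 1 in \<open>k + 1\<close>.\<close>
  define D where "D = insert UNIV (A ` {..<n})"
  define x where "x i = (case i of 0 \<Rightarrow> UNIV | Suc v \<Rightarrow> A v)" for i
  define h where "h S = (\<lambda>Y\<in>D. \<Sum>j\<in>S \<inter> Y. c j div g)" for S :: "nat set"
  have D: "finite D" "card D \<le> k + 1"
    using k card_insert_le_m1[of "k + 1" "A ` {..<n}" UNIV] unfolding D_def distinct_votes_def by auto
  have "h ` Z \<subseteq> D \<rightarrow>\<^sub>E {..m * d}"
  proof (clarsimp simp: h_def)
    fix S Y assume "S \<in> Z"
    then have S: "S \<subseteq> {..<m}" by (rule Z)
    then have "(\<Sum>j\<in>S \<inter> Y. c j div g) \<le> (\<Sum>j\<in>S \<inter> Y. d)" by (intro sum_mono c) auto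
    also have "\<dots> \<le> m * d"
      using card_mono[of "{..<m}" "S \<inter> Y"] S by auto
    finally show "(\<Sum>j\<in>S \<inter> Y. c j div g) \<le> m * d" .
  qed
  then have "card (h ` Z) \<le> (m * d + 1) ^ card D"
    using card_mono[OF finite_PiE, of D "\<lambda>_. {..m * d}" "h ` Z"] D by (simp add: card_funcsetE)
  also have "\<dots> \<le> (m * d + 1) ^ (k + 1)" using D by (intro power_increasing) auto
  finally have le: "card (h ` Z) \<le> (m * d + 1) ^ (k + 1)" .
  have "vecs (rows c A) N S = map (\<lambda>i. g * h S (x i)) [0..<N]" if "S \<in> Z" for S
    unfolding vecs_def
  proof (rule map_cong[OF refl])
    fix i assume "i \<in> set [0..<N]"
    then have i: "x i \<in> D" using N by (auto simp: x_def D_def split: nat.split)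
    have S: "S \<subseteq> {..<m}" "finite S" using Z[OF that] finite_subset by auto
    have "vec (rows c A) S i = (\<Sum>j\<in>S \<inter> x i. c j)"
      using S(2) vec_rows_0[of c A S] vec_rows_Suc[of S c A]
      by (cases i) (simp_all add: x_def utility_def set_cost_def)
    also have "\<dots> = (\<Sum>j\<in>S \<inter> x i. g * (c j div g))"
      using S(1) by (intro sum.cong c(1)) auto
    also have "\<dots> = g * h S (x i)" using i by (simp add: h_def sum_distrib_left)
    finally show "vec (rows c A) S i = g * h S (x i)" .
  qed
  then have "vecs (rows c A) N ` Z = (\<lambda>f. map (\<lambda>i. g * f (x i)) [0..<N]) ` h ` Z"
    by (auto simp: image_image)
  moreover have "finite Z" using Z finite_subset[of Z "Pow {..<m}"] by auto
  ultimately show ?thesis using card_image_le[of "h ` Z"] le by (metis finite_imageI le_trans)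
qed

section \<open>The complete program and its time bound\<close>

definition solver :: com where
  "solver = setup_code ;; main_loop ;; select ;; output_code"

text \<open>Utilities never exceed the cost, so row 0 does not affect the minimum unless there are no voters.\<close>

lemma egal_eq_Min_vec:
  assumes "finite S" "0 < n"
  shows "egal n c A S = Min (vec (rows c A) S ` {..<Suc n})"
proof -
  have "Min (vec (rows c A) S ` {..<Suc n}) = min (set_cost c S) (egal n c A S)"
    using assms
    by (simp add: lessThan_Suc_eq_insert_0 image_image vec_rows_0 vec_rows_Suc egal_def lessThan_empty_iff)
  moreover have "egal n c A S \<le> utility c A 0 S"
    unfolding egal_def using assms by (intro Min_le) auto
  moreover have "utility c A 0 S \<le> set_cost c S"
    unfolding utility_def set_cost_def using assms(1) by (intro sum_mono2) auto
  ultimately show ?thesis by simp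
qed

text \<open>The bound of \<open>wp_main_loop\<close> with \<open>insert_time\<close> and
  \<open>round_time\<close> unfolded and both \<open>N\<close> and \<open>m\<close> replaced by the
  input length \<open>u\<close>.\<close>

definition rounds_time :: "nat \<Rightarrow> nat \<Rightarrow> nat" where
  "rounds_time X u = u * (X * (X * (12 * u + 15) + 8 * (u + u) + 11 * u + 28 + 5) + 6 + 5) + 1"

definition total_time :: "nat \<Rightarrow> nat \<Rightarrow> nat" where
  "total_time X u = (256 * u + 100) + (rounds_time X u + ((X * (8 * u + 18) + 8) + (8 * u + 70)))"

lemma wp_solver:
  fixes n m b :: nat and c A
  defines "xs \<equiv> encode_instance n m c b A"
  assumes k: "distinct_votes n A \<le> k" and d: "scalable_limit m c b \<le> d"
  shows "wp solver (total_time ((length xs * d + 1) ^ (k + 1)) (length xs))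
    (\<lambda>s. s 0 = m \<and> (\<exists>S. S \<subseteq> {..<m} \<and> mpb_optimal n m c b A S \<and> (\<forall>j<m. s (Suc j) = of_bool (j \<in> S))))
    (snd (init_conf xs))"
proof -
  define len where "len = length xs"
  define N where "N = (if m = 0 then 1 else Suc n)"
  define X where "X = (len * d + 1) ^ (k + 1)"
  define z l where "z = 32 * len + 3" and "l = 64 * len + 6"
  have len: "len = 3 + m + n * m" by (simp add: len_def xs_def length_encode)
  have Nm: "N * m + 3 \<le> len" and Nlen: "N \<le> len" and mlen: "m \<le> len"
    unfolding len N_def by (cases m; simp)+
  interpret layout "rows c A" N m b z l X
  proof
    show "0 < N" by (simp add: N_def)
    show "25 < z" using len by (simp add: z_def)
    show "z + N * m \<le> l" using Nm by (simp add: z_def l_def)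
    fix Ss assume sep: "table.separated (rows c A) N m Ss"
    then have sep: "distinct (map (vecs (rows c A) N) Ss)" "\<forall>S\<in>set Ss. S \<subseteq> {..<m}"
      using table.separated_def[of N "rows c A" m Ss] by (simp_all add: table_def N_def)
    have "length Ss = card (vecs (rows c A) N ` set Ss)"
      using distinct_card[OF sep(1)] by simp
    also have "\<dots> \<le> (m * d + 1) ^ (k + 1)"
      by (rule card_profiles) (use sep k d in \<open>auto simp: N_def\<close>)
    also have "\<dots> \<le> X" unfolding X_def using mlen by (intro power_mono) auto
    finally show "length Ss \<le> X" .
  qed
  have l: "96 < l" using len by (simp add: l_def)
  define P where "P = (\<lambda>s. s 0 = m \<and> (\<exists>S. S \<subseteq> {..<m} \<and> mpb_optimal n m c b A S \<and>
    (\<forall>j<m. s (Suc j) = of_bool (j \<in> S))))"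
  have 1: "wp setup_code (256 * len + 100) (\<lambda>s. base s \<and> stores s [{}] \<and> s 8 = z \<and> s 9 = m) (snd (init_conf xs))"
  proof (rule wp_post[OF wp_setup])
    fix s assume *: "s 1 = 1 \<and> s 2 = (if xs ! 1 = 0 then 1 else Suc (xs ! 0)) \<and> s 3 = xs ! 1 \<and> s 4 = xs ! 2
      \<and> s 5 = 64 * length xs + 6 \<and> s 7 = s 2 + s 3 \<and> s 6 = s 5 + s 7
      \<and> s 8 = 32 * length xs + 3 \<and> s 9 = xs ! 1 \<and> s 13 = 1
      \<and> (\<forall>a<length xs. s (32 * length xs + a) = xs ! a) \<and> (\<forall>a\<ge>64 * length xs + 6. s a = 0)"
    have hd: "xs ! 0 = n" "xs ! 1 = m" "xs ! 2 = b" unfolding xs_def by (rule encode_header)+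
    have "s (z + i * m + j) = rows c A i j" if "i < N" "j < m" for i j
    proof -
      have "i < Suc n" using that unfolding N_def by (simp split: if_splits)
      moreover have "3 + i * m + j < len" using cell_less[OF that] mult_le_mono1[of "Suc i" N m] that Nm by simp
      ultimately have "s (32 * len + (3 + i * m + j)) = rows c A i j"
        using * encode_rows[of i n j m c b A] that(2) unfolding len_def xs_def by simp
      then show ?thesis by (simp add: z_def add.assoc)
    qed
    moreover have "s 1 = 1" "s 2 = N" "s 3 = m" "s 4 = b" "s 5 = l" "s 7 = R" "s 6 = l + R" "s 13 = 1" "s 8 = z" "s 9 = m"
      using * hd unfolding N_def l_def z_def len_def by simp_all
    moreover have "s (l + a) = 0" for a using * unfolding l_def len_def by simp
    ultimately show "base s \<and> stores s [{}] \<and> s 8 = z \<and> s 9 = m"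
      unfolding base_def stores_def by (simp add: vec_def add.assoc)
  qed (use len in \<open>auto simp: len_def\<close>)
  define L where "L = length (reps m)"
  have L: "L \<le> X" "0 < L" using X[OF separated_reps] reps_ne by (auto simp: L_def)
  define mv where "mv S = Min (vec (rows c A) S ` {..<N})" for S
  define C where "C = (\<lambda>s. \<exists>S\<in>set (reps m). (\<forall>S'\<in>set (reps m). mv S' \<le> mv S) \<and>
    s 1 = 1 \<and> s 2 = N \<and> s 3 = m \<and> l \<le> s 25 \<and> (\<forall>j<m. s (s 25 + N + j) = of_bool (j \<in> S)))"
  have 2: "wp main_loop (m * (round_time + 5) + 1) (\<lambda>s'. base s' \<and> stores s' (reps m)) s"
    if "base s \<and> stores s [{}] \<and> s 8 = z \<and> s 9 = m" for s
    using that by (intro wp_main_loop) auto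
  have 3: "wp select (X * (8 * N + 18) + 8) C s" if bs: "base s \<and> stores s (reps m)" for s
  proof (rule wp_post[OF wp_select[where N = N and l = l and R = R and L = L]])
    have cell: "s (l + q * R + i) = vec (rows c A) (reps m ! q) i" if "q < L" "i < N" for q i
      using bs that unfolding stores_def L_def by blast
    have cells: "Min ((\<lambda>i. s (l + q * R + i)) ` {..<N}) = mv (reps m ! q)" if "q < L" for q
      unfolding mv_def using cell[OF that] by (intro arg_cong[where f = Min] image_cong) auto
    fix s' assume *: "(\<exists>q<L. s' 25 = l + q * R \<and>
      (\<forall>q'<L. Min ((\<lambda>i. s (l + q' * R + i)) ` {..<N}) \<le> Min ((\<lambda>i. s (l + q * R + i)) ` {..<N})))
      \<and> (\<forall>a. a \<notin> {0, 14, 16, 17, 18, 21, 22, 24, 25} \<longrightarrow> s' a = s a)"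
    then obtain q where q: "q < L" "s' 25 = l + q * R" and best: "\<And>q'. q' < L \<Longrightarrow> mv (reps m ! q') \<le> mv (reps m ! q)"
      using cells by auto
    have "\<forall>S'\<in>set (reps m). mv S' \<le> mv (reps m ! q)"
      using best unfolding L_def by (metis in_set_conv_nth)
    moreover have "s' (s' 25 + N + j) = of_bool (j \<in> reps m ! q)" if "j < m" for j
    proof -
      have "s' (s' 25 + N + j) = s (s' 25 + N + j)" using * q(2) l by simp
      then show ?thesis using bs q that unfolding stores_def L_def by simp
    qed
    moreover have "s' 1 = 1" "s' 2 = N" "s' 3 = m" using * bs unfolding base_def by auto
    ultimately show "C s'"
      unfolding C_def using q by (intro bexI[of _ "reps m ! q"]) (auto simp: L_def)
  qed (use bs l L N in \<open>auto simp: base_def stores_def L_def\<close>)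
  have opt: "mpb_optimal n m c b A S" if S: "S \<in> set (reps m)" and best: "\<forall>S'\<in>set (reps m). mv S' \<le> mv S" for S
    unfolding mpb_optimal_def
  proof (intro conjI allI impI)
    have S': "S \<subseteq> {..<m}" "set_cost c S \<le> b"
      using reps_sound[of m] S by (auto simp: vec_rows_0)
    then show "feasible m c b S" unfolding feasible_def by simp
    fix T assume "feasible m c b T"
    then have T: "T \<subseteq> {..<m}" "set_cost c T \<le> b" unfolding feasible_def by auto
    show "egal n c A T \<le> egal n c A S"
    \<comment> \<open>Without voters both sides are the same unspecified value
      \<open>Min {}\<close>; without projects both sets are empty.\<close>
    proof (cases "m = 0 \<or> n = 0")
      case True
      then show ?thesis using S' T by (auto simp: egal_def)
    next
      case False
      have "vecs (rows c A) N T \<in> vecs (rows c A) N ` set (reps m)"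
        using reps_complete[OF T(1)] T(2) by (simp add: vec_rows_0)
      then obtain S1 where "S1 \<in> set (reps m)" "vecs (rows c A) N T = vecs (rows c A) N S1" by auto
      then have "mv T \<le> mv S" using best by (simp add: vecs_eq_iff mv_def cong: image_cong_simp)
      moreover have "finite S" "finite T" using S' T finite_subset by blast+
      ultimately show ?thesis using False by (simp add: egal_eq_Min_vec mv_def N_def)
    qed
  qed
  have 4: "wp output_code (8 * m + 70) P s" if C: "C s" for s
  proof -
    obtain S where S: "S \<in> set (reps m)" "\<forall>S'\<in>set (reps m). mv S' \<le> mv S"
      and s: "s 1 = 1" "s 2 = N" "s 3 = m" "l \<le> s 25" "\<forall>j<m. s (s 25 + N + j) = of_bool (j \<in> S)"
      using C unfolding C_def by blast
    have "m < l" using mlen by (simp add: l_def)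
    then show ?thesis
      using s l reps_sound[of m] S opt[OF S]
      by (intro wp_post[OF wp_output[where N = N and m = m and p = "s 25"]]) (auto simp: P_def)
  qed
  have insert_time: "insert_time \<le> X * (12 * len + 15) + 8 * (len + len) + 11 * len + 28"
    unfolding insert_time_def using Nlen mlen by (intro add_mono mult_le_mono) auto
  have "m * (round_time + 5) + 1 \<le> rounds_time X len"
    unfolding round_time_def rounds_time_def using insert_time mlen by (intro add_mono mult_le_mono) auto
  moreover have "X * (8 * N + 18) + 8 \<le> X * (8 * len + 18) + 8" "8 * m + 70 \<le> 8 * len + 70"
    using Nlen mlen by auto
  ultimately have "(256 * len + 100) + ((m * (round_time + 5) + 1) + ((X * (8 * N + 18) + 8) + (8 * m + 70))) \<le> total_time X len"
    unfolding total_time_def by (intro add_mono) auto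
  then have "wp solver (total_time X len) P (snd (init_conf xs))"
    unfolding solver_def by (intro wp_Seq[OF 1 wp_Seq[OF 2 wp_Seq[OF 3 4 order.refl] order.refl]])
  then show ?thesis unfolding P_def X_def len_def .
qed

section \<open>Polynomial bounds\<close>

definition poly_bounded :: "(nat \<Rightarrow> nat) \<Rightarrow> bool" where
  "poly_bounded f \<longleftrightarrow> (\<exists>a e. \<forall>x. f x \<le> a * (x + 1) ^ e)"

lemma poly_bounded_const: "poly_bounded (\<lambda>_. a)"
  unfolding poly_bounded_def by (intro exI[of _ a] exI[of _ 0]) simp

lemma poly_bounded_id: "poly_bounded (\<lambda>x. x)"
  unfolding poly_bounded_def by (intro exI[of _ 1] exI[of _ 1]) simp

lemma poly_bounded_mult:
  assumes "poly_bounded f" "poly_bounded g"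
  shows "poly_bounded (\<lambda>x. f x * g x)"
proof -
  obtain a e a' e' where *: "\<And>x. f x \<le> a * (x + 1) ^ e" "\<And>x. g x \<le> a' * (x + 1) ^ e'"
    using assms unfolding poly_bounded_def by blast
  have "f x * g x \<le> (a * a') * (x + 1) ^ (e + e')" for x
    using mult_le_mono[OF *] by (simp add: power_add mult.assoc mult.left_commute)
  then show ?thesis unfolding poly_bounded_def by blast
qed

lemma poly_bounded_add:
  assumes "poly_bounded f" "poly_bounded g"
  shows "poly_bounded (\<lambda>x. f x + g x)"
proof -
  obtain a e a' e' where *: "\<And>x. f x \<le> a * (x + 1) ^ e" "\<And>x. g x \<le> a' * (x + 1) ^ e'"
    using assms unfolding poly_bounded_def by blast
  have "f x + g x \<le> (a + a') * (x + 1) ^ (e + e')" for x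
  proof -
    have "a * (x + 1) ^ e \<le> a * (x + 1) ^ (e + e')" "a' * (x + 1) ^ e' \<le> a' * (x + 1) ^ (e + e')"
      by (intro mult_le_mono2 power_increasing; simp)+
    then show ?thesis using *[of x] unfolding distrib_right by linarith
  qed
  then show ?thesis unfolding poly_bounded_def by blast
qed

lemma poly_bounded_power: "poly_bounded f \<Longrightarrow> poly_bounded (\<lambda>x. f x ^ k)"
  by (induction k) (auto intro: poly_bounded_const poly_bounded_mult)

text \<open>Here \<open>k\<close> and \<open>d\<close> are constants, so the list bound is a
  polynomial in \<open>u\<close> and the closure rules follow the shape of the definitions.\<close>

lemma poly_bounded_total_time: "poly_bounded (\<lambda>u. total_time ((u * d + 1) ^ (k + 1)) u)"
  unfolding total_time_def rounds_time_def
  by (intro poly_bounded_add poly_bounded_mult poly_bounded_power poly_bounded_const poly_bounded_id)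

text \<open>The final claim inspects the configuration after exactly the bounding number of steps; a
  halted configuration no longer changes, so halting earlier suffices.\<close>

lemma run_halted:
  assumes "(step p ^^ t) cf = cf'" "halted p cf'" "t \<le> t'"
  shows "run p t' cf = cf'"
proof -
  have "(step p ^^ r) cf' = cf'" for r
    by (induction r) (use assms(2) in \<open>auto simp: step_def\<close>)
  moreover have "t' = (t' - t) + t" using assms(3) by simp
  ultimately show ?thesis using assms(1) unfolding run_def by (metis funpow_add o_apply)
qed

theorem theorem4:
  fixes k d :: nat
  shows "\<exists>(p :: prog) (a :: nat) (e :: nat).
    \<forall>n m c b A.
      pb_valid n m c b A \<longrightarrow>
      distinct_votes n A \<le> k \<longrightarrow>
      scalable_limit m c b \<le> d \<longrightarrow>
      (let xs = encode_instance n m c b A;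
           cf = run p (a * (input_size xs + 1) ^ e) (init_conf xs)
       in halted p cf \<and>
          (\<exists>S. decodes_to m (ram_output cf) S \<and> mpb_optimal n m c b A S))"
proof -
  obtain a e where ae: "\<And>u. total_time ((u * d + 1) ^ (k + 1)) u \<le> a * (u + 1) ^ e"
    using poly_bounded_total_time unfolding poly_bounded_def by blast
  define p where "p = compile 0 solver"
  show ?thesis
  proof (rule exI[of _ p], rule exI[of _ a], rule exI[of _ e], intro allI impI)
    fix n m c b A
    assume k: "distinct_votes n A \<le> k" and d: "scalable_limit m c b \<le> d"
    define xs where "xs = encode_instance n m c b A"
    \<comment> \<open>In the empty context the end of the code is the end of the program, which is
      the halting condition.\<close>
    obtain t s S where t: "t \<le> total_time ((length xs * d + 1) ^ (k + 1)) (length xs)"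
      and run: "(step p ^^ t) (0, snd (init_conf xs)) = (csize solver, s)"
      and out: "s 0 = m" "S \<subseteq> {..<m}" "mpb_optimal n m c b A S" "\<forall>j<m. s (Suc j) = of_bool (j \<in> S)"
      using wp_solver[OF k d, unfolded wp_def, rule_format, of "[]" "[]"] unfolding xs_def p_def by auto
    have halted: "halted p (csize solver, s)" by (simp add: halted_def p_def)
    have "a * (length xs + 1) ^ e \<le> a * (input_size xs + 1) ^ e"
      using length_le_input_size by (intro mult_le_mono2 power_mono) auto
    then have "t \<le> a * (input_size xs + 1) ^ e" using t ae le_trans by blast
    moreover have "init_conf xs = (0, snd (init_conf xs))" by (simp add: init_conf_def)
    ultimately have cf: "run p (a * (input_size xs + 1) ^ e) (init_conf xs) = (csize solver, s)"
      using run_halted[OF run halted] by simp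
    have "decodes_to m (ram_output (csize solver, s)) S"
      using out unfolding decodes_to_def ram_output_def by (auto simp: of_bool_def split: if_splits)
    then show "let xs = encode_instance n m c b A; cf = run p (a * (input_size xs + 1) ^ e) (init_conf xs)
       in halted p cf \<and> (\<exists>S. decodes_to m (ram_output cf) S \<and> mpb_optimal n m c b A S)"
      using halted out(3) unfolding xs_def[symmetric] Let_def cf by blast
  qed
qed

end
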